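(* Let $0\le\alpha<1$ be fixed. For $a>1$ let $0<t_{1}<t_{2}<t_{3}<\cdots$ denote the positive zeros $\theta=t_m=t_m(a)$ of $\theta\mapsto\mathrm{Ti}(a,a\theta,\alpha)$, and for $m=1,2,3,\ldots$ let $t_{m,0}=t_{m,0}(a)$ be the positive root of $$a t_{m,0}-\arctan(t_{m,0})=\left(m-l+\alpha-\tfrac12\right)\pi,$$ where $l=0$ if $0\le\alpha\le\tfrac12$ and $l=1$ if $\tfrac12<\alpha<1$. Then $$t_{m}\sim t_{m,0}+\sum_{k=2}^{\infty}\frac{q_{k}(t_{m,0})}{a^{k}}\qquad(a\to+\infty)$$ uniformly for $m=1,2,3,\ldots$; that is, for every integer $N\ge1$, $t_m-t_{m,0}-\sum_{k=2}^{N}q_k(t_{m,0})a^{-k}=\mathcal{O}(a^{-N-1})$ as $a\to+\infty$, uniformly in $m\ge1$, where $q_k(x)$ are the rational functions defined in the context.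
   Context: For $a>0$: $\mathrm{Ci}(a,z)=\int_0^z t^{a-1}\cos t\,dt$, $\mathrm{Si}(a,z)=\int_0^z t^{a-1}\sin t\,dt$, and $\mathrm{Ti}(a,z,\alpha)=\mathrm{Ci}(a,z)\cos(\pi\alpha)+\mathrm{Si}(a,z)\sin(\pi\alpha)$. Coefficients: $F^{-}_{0}(z)=-\dfrac{z}{(z-1)^{2}}$, $F^{-}_{1}(z)=-\dfrac{2z(z+1)}{(z-1)^{4}}$, and for $s=1,2,3,\ldots$ $$F^{-}_{s+1}(z)=\frac{z}{1-z}\frac{dF^{-}_{s}(z)}{dz}-\frac12\sum_{j=0}^{s}F^{-}_{j}(z)F^{-}_{s-j}(z).$$ For $s\ge1$, $E^{-}_{s}$ is the rational function with $E^{-}_{s}(0)=0$ given by $E^{-}_{s}(z)=\int_{0}^{z}\frac{(t-1)F^{-}_{s}(t)}{2t}\,dt$ (e.g. $E^{-}_{1}(z)=\frac{z}{(z-1)^{2}}$, $E^{-}_{2}(z)=\frac{z(3z+2)}{2(z-1)^{4}}$). For real $\theta$ put $L_{s}(\theta)=(-1)^{s}\Im\{E^{-}_{s}(-i\theta)\}$, a real rational function of $\theta$. The functions $q_k(x)$ ($k=2,3,4,\ldots$) are the unique functions such that, as an identity of formal power series in $1/a$, the substitution $\theta=x+\sum_{k\ge2}q_k(x)a^{-k}$ gives $$a\theta-\arctan(\theta)+\sum_{s=1}^{\infty}\frac{L_s(\theta)}{a^{s}}=ax-\arctan(x)$$ (expand in inverse powers of $a$ and equate like powers). They are rational functions; the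 first two are $q_{2}(x)=\frac{x(x^2-1)}{(x^2+1)^2}$ and $q_{3}(x)=\frac{4x^3(2x^2-3)}{(x^2+1)^4}$. *)

theory Defs
  imports
    "HOL-Complex_Analysis.Complex_Analysis"
    "HOL-Computational_Algebra.Formal_Laurent_Series"
begin

definition Ci_fun :: "real \<Rightarrow> real \<Rightarrow> real" where
  "Ci_fun a z = integral {0..z} (\<lambda>t. t powr (a - 1) * cos t)"

definition Si_fun :: "real \<Rightarrow> real \<Rightarrow> real" where
  "Si_fun a z = integral {0..z} (\<lambda>t. t powr (a - 1) * sin t)"

definition Ti_fun :: "real \<Rightarrow> real \<Rightarrow> real \<Rightarrow> real" where
  "Ti_fun a z \<alpha> = Ci_fun a z * cos (pi * \<alpha>) + Si_fun a z * sin (pi * \<alpha>)"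

fun F_minus :: "nat \<Rightarrow> complex \<Rightarrow> complex" where
  "F_minus 0 = (\<lambda>z. - z / (z - 1) ^ 2)"
| "F_minus (Suc 0) = (\<lambda>z. - (2 * z * (z + 1)) / (z - 1) ^ 4)"
| "F_minus (Suc (Suc s)) = (\<lambda>z. z / (1 - z) * deriv (F_minus (Suc s)) z
      - 1 / 2 * (\<Sum>j\<in>{0..Suc s}. F_minus j z * F_minus (Suc s - j) z))"

(* The path is the segment from 0 to z. It avoids the only pole, t = 1, unless z is real and
   at least 1; L_coeff evaluates E_minus on the imaginary axis only. The singularity of the
   integrand at t = 0 is removable. *)
definition E_minus :: "nat \<Rightarrow> complex \<Rightarrow> complex" where
  "E_minus s z = contour_integral (linepath 0 z) (\<lambda>t. (t - 1) * F_minus s t / (2 * t))"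

definition L_coeff :: "nat \<Rightarrow> real \<Rightarrow> real" where
  "L_coeff s \<theta> = (- 1) ^ s * Im (E_minus s (- \<i> * complex_of_real \<theta>))"

(* The formal series of f(T), that is, the Taylor series of f at the constant term of T
   with T minus that constant term substituted. *)
definition fps_subst :: "(real \<Rightarrow> real) \<Rightarrow> real fps \<Rightarrow> real fps" where
  "fps_subst f T =
     Abs_fps (\<lambda>n. (deriv ^^ n) f (fps_nth T 0) / fact n) oo (T - fps_const (fps_nth T 0))"

(* Formal series are in the variable X = 1/a, so that fls_X_inv stands for a; the factor a in
   a * T makes this an identity of Laurent series. The infinite sum converges X-adically;
   its summand with index s is the term L_{s+1} / a^(s+1). *)
definition theta_identity :: "real \<Rightarrow> real fps \<Rightarrow> bool" where
  "theta_identity x T \<longleftrightarrow>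
     fls_X_inv * fps_to_fls T - fps_to_fls (fps_subst arctan T)
       + fps_to_fls (\<Sum>s. fps_subst (L_coeff (Suc s)) T * fps_X ^ Suc s)
     = fls_X_inv * fls_const x - fls_const (arctan x)"

definition theta_series :: "real \<Rightarrow> real fps" where
  "theta_series x = (THE T. fps_nth T 0 = x \<and> fps_nth T 1 = 0 \<and> theta_identity x T)"

definition q_coeff :: "nat \<Rightarrow> real \<Rightarrow> real" where
  "q_coeff k x = fps_nth (theta_series x) k"

(* The increasing enumeration t 1 < t 2 < ... of all positive zeros; the value t 0 = 0 is
   only a convention and makes the enumeration unique. *)
definition Ti_zero :: "real \<Rightarrow> real \<Rightarrow> nat \<Rightarrow> real" where
  "Ti_zero \<alpha> a = (THE t. strict_mono t \<and> t 0 = 0 \<and>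
     t ` {1..} = {\<theta>. \<theta> > 0 \<and> Ti_fun a (a * \<theta>) \<alpha> = 0})"

definition l_shift :: "real \<Rightarrow> real" where
  "l_shift \<alpha> = (if \<alpha> \<le> 1 / 2 then 0 else 1)"

definition t_approx :: "real \<Rightarrow> real \<Rightarrow> nat \<Rightarrow> real" where
  "t_approx \<alpha> a m = (THE \<theta>. \<theta> > 0 \<and>
     a * \<theta> - arctan \<theta> = (real m - l_shift \<alpha> + \<alpha> - 1 / 2) * pi)"

end

theory Submission
  imports Defs
begin

text \<open>
  The function Ti(a, a\<theta>, \<alpha>) is the real part of e^(-\<i>\<pi>\<alpha>) J, where J is the integral of t^(a-1) e^(\<i>t)
  over [0, a\<theta>]. Writing w = 1/(1 + \<i>\<theta>) and J = (a\<theta>)^a e^(\<i>a\<theta>) w K / a, one finds that \<theta> is a zero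
  if and only if the phase P(\<theta>) = a\<theta> - arctan \<theta> + Im (log K) equals (k + \<alpha> - 1/2)\<pi> for an integer k.
  For large a the phase increases strictly from 0 to infinity, so that the m-th zero is the
  solution of P(\<theta>) = (m - l + \<alpha> - 1/2)\<pi> (lemma Ti_zero_phase). The right-hand side is ax - arctan x
  with x the root t_approx, so everything rests on an expansion of log K in powers of 1/a that is
  uniform in \<theta> > 0, and on its formal inversion.

  The expansion of K. Since J is an integral, wK satisfies a linear differential equation of first
  order, and 1/K satisfies a Riccati equation. All coefficients of their formal solutions in powers of
  1/a are polynomials in w, and w lies in the unit disc; this replaces all discussions of rational
  functions of \<theta>, and it makes all bounds uniform. The recursion of F_minus is the Riccati recursion
  for 1/K, and integrating F_minus gives the coefficients of log K, so that L_coeff s is the imaginary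
  part of the s-th coefficient of log K (lemmas F_minus_eq, E_minus_eq, recip_log_derivative). That the
  formal solution is asymptotic to the true one follows from an elementary comparison of
  solutions of the linear equation (lemma Ti_amplitude_comparison), whose error is weighted by
  |w| |w - 1| = \<theta>/(1 + \<theta>^2): it is a relative error for large \<theta> and vanishes at \<theta> = 0. The outcome is
  lemma Ti_phase_expansion.

  The inversion. The identity that defines the q_k is a fixed point equation for a formal power
  series in which each coefficient is determined by the preceding ones; the q_k are bounded in x because
  arctan and the L_coeff s have bounded derivatives of all orders. Truncating the series at order N
  solves the truncated equation up to O(a^(-N)) uniformly in x (lemma theta_partial_sum_residual). The
  m-th zero solves the same equation with an even smaller error, and the left-hand side of the
  equation has slope at least a/2, so the two solutions differ by O(a^(-N-1)).
\<close>

unbundle no vec_syntax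
unbundle fps_syntax

section \<open>Expansions in powers of a small parameter, uniform in an index\<close>


text \<open>
  Here \<phi> i \<epsilon> is a number depending on a parameter i in I and on \<epsilon> in (0,1], and A i is its
  expansion in powers of \<epsilon>. One constant C has to serve all i: this is where the uniformity in m of
  the final estimate comes from. The coefficients are required to be bounded as well, because
  otherwise products of expansions would not be expansions.
\<close>
definition expands ::
    "'i set \<Rightarrow> nat \<Rightarrow> ('i \<Rightarrow> 'a::real_normed_field fps) \<Rightarrow> ('i \<Rightarrow> real \<Rightarrow> 'a) \<Rightarrow> bool" where
  "expands I n A \<phi> \<longleftrightarrow> (\<exists>C. \<forall>i\<in>I. (\<forall>k\<le>n. norm (A i $ k) \<le> C) \<and>
     (\<forall>\<epsilon>. 0 < \<epsilon> \<longrightarrow> \<epsilon> \<le> 1 \<longrightarrow>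
        norm (\<phi> i \<epsilon> - (\<Sum>k\<le>n. A i $ k * of_real \<epsilon> ^ k)) \<le> C * \<epsilon> ^ Suc n))"

lemma expandsE:
  assumes "expands I n A \<phi>"
  obtains C where "C \<ge> 0" "\<And>i k. i \<in> I \<Longrightarrow> k \<le> n \<Longrightarrow> norm (A i $ k) \<le> C"
    "\<And>i \<epsilon>. i \<in> I \<Longrightarrow> 0 < \<epsilon> \<Longrightarrow> \<epsilon> \<le> 1 \<Longrightarrow>
        norm (\<phi> i \<epsilon> - (\<Sum>k\<le>n. A i $ k * of_real \<epsilon> ^ k)) \<le> C * \<epsilon> ^ Suc n"
proof -
  obtain C where C: "\<forall>i\<in>I. (\<forall>k\<le>n. norm (A i $ k) \<le> C) \<and>
     (\<forall>\<epsilon>. 0 < \<epsilon> \<longrightarrow> \<epsilon> \<le> 1 \<longrightarrow>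
        norm (\<phi> i \<epsilon> - (\<Sum>k\<le>n. A i $ k * of_real \<epsilon> ^ k)) \<le> C * \<epsilon> ^ Suc n)"
    using assms unfolding expands_def by blast
  have le: "C * \<epsilon> ^ Suc n \<le> max C 0 * \<epsilon> ^ Suc n" if "0 < \<epsilon>" for \<epsilon> :: real
    using that by (intro mult_right_mono) auto
  show thesis
    by (rule that[of "max C 0"]) (use C in \<open>auto intro!: order_trans[OF _ le] simp: le_max_iff_disj simp del: power_Suc\<close>)
qed

lemma expandsI:
  assumes "\<And>i k. i \<in> I \<Longrightarrow> k \<le> n \<Longrightarrow> norm (A i $ k) \<le> B"
    "\<And>i \<epsilon>. i \<in> I \<Longrightarrow> 0 < \<epsilon> \<Longrightarrow> \<epsilon> \<le> 1 \<Longrightarrow>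
        norm (\<phi> i \<epsilon> - (\<Sum>k\<le>n. A i $ k * of_real \<epsilon> ^ k)) \<le> C * \<epsilon> ^ Suc n"
  shows "expands I n A \<phi>"
proof -
  have le: "C * \<epsilon> ^ Suc n \<le> max B C * \<epsilon> ^ Suc n" if "0 < \<epsilon>" for \<epsilon> :: real
    using that by (intro mult_right_mono) auto
  show ?thesis
    unfolding expands_def
    by (rule exI[of _ "max B C"])
      (use assms in \<open>auto intro!: order_trans[OF _ le] simp: le_max_iff_disj simp del: power_Suc\<close>)
qed

lemma expands_cong:
  assumes "expands I n A \<phi>" "\<And>i k. i \<in> I \<Longrightarrow> k \<le> n \<Longrightarrow> B i $ k = A i $ k"
    "\<And>i \<epsilon>. i \<in> I \<Longrightarrow> 0 < \<epsilon> \<Longrightarrow> \<epsilon> \<le> 1 \<Longrightarrow> \<psi> i \<epsilon> = \<phi> i \<epsilon>"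
  shows "expands I n B \<psi>"
  using assms unfolding expands_def by simp

lemma expands_polynomial:
  assumes "\<And>k. k \<le> n \<Longrightarrow> \<exists>C. \<forall>i\<in>I. norm (A i $ k) \<le> C"
  shows "expands I n A (\<lambda>i \<epsilon>. \<Sum>k\<le>n. A i $ k * of_real \<epsilon> ^ k)"
proof -
  obtain C where C: "\<And>k i. k \<le> n \<Longrightarrow> i \<in> I \<Longrightarrow> norm (A i $ k) \<le> C k"
    using assms by metis
  have "norm (A i $ k) \<le> Max (C ` {..n})" if "k \<le> n" "i \<in> I" for i k
    using that by (intro order_trans[OF C Max_ge]) auto
  then show ?thesis by (intro expandsI[where C = 0]) auto
qed

lemma expands_const:
  assumes "\<And>i. i \<in> I \<Longrightarrow> norm (c i) \<le> C"
  shows "expands I n (\<lambda>i. fps_const (c i)) (\<lambda>i \<epsilon>. c i)"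
proof (rule expandsI[where C = 0 and B = "max C 0"])
  fix i k assume "i \<in> I"
  then show "norm (fps_const (c i) $ k) \<le> max C 0"
    using assms[of i] by (cases k) auto
next
  fix i and \<epsilon> :: real
  have "(\<Sum>k\<le>n. fps_const (c i) $ k * of_real \<epsilon> ^ k) = (\<Sum>k\<in>{0}. fps_const (c i) $ k * of_real \<epsilon> ^ k)"
    by (intro sum.mono_neutral_right) auto
  then show "norm (c i - (\<Sum>k\<le>n. fps_const (c i) $ k * of_real \<epsilon> ^ k)) \<le> 0 * \<epsilon> ^ Suc n" by simp
qed

lemma expands_X: "expands I n (\<lambda>i. fps_X) (\<lambda>i \<epsilon>. of_real \<epsilon>)"
proof (rule expandsI[where C = 1 and B = 1])
  fix i and \<epsilon> :: real assume e: "0 < \<epsilon>" "\<epsilon> \<le> 1"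
  have "(\<Sum>k\<le>n. fps_X $ k * of_real \<epsilon> ^ k) = (\<Sum>k\<in>{..n} \<inter> {1}. fps_X $ k * of_real \<epsilon> ^ k :: 'b)"
    by (intro sum.mono_neutral_right) auto
  then show "norm (of_real \<epsilon> - (\<Sum>k\<le>n. fps_X $ k * of_real \<epsilon> ^ k :: 'b)) \<le> 1 * \<epsilon> ^ Suc n"
    using e by (cases n) auto
qed (auto simp: fps_X_def)

lemma expands_add:
  assumes "expands I n A \<phi>" "expands I n B \<psi>"
  shows "expands I n (\<lambda>i. A i + B i) (\<lambda>i \<epsilon>. \<phi> i \<epsilon> + \<psi> i \<epsilon>)"
proof -
  obtain C where C: "C \<ge> 0" "\<And>i k. i \<in> I \<Longrightarrow> k \<le> n \<Longrightarrow> norm (A i $ k) \<le> C"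
    "\<And>i \<epsilon>. i \<in> I \<Longrightarrow> 0 < \<epsilon> \<Longrightarrow> \<epsilon> \<le> 1 \<Longrightarrow>
        norm (\<phi> i \<epsilon> - (\<Sum>k\<le>n. A i $ k * of_real \<epsilon> ^ k)) \<le> C * \<epsilon> ^ Suc n"
    using assms(1) by (rule expandsE) (rule that)
  obtain D where D: "D \<ge> 0" "\<And>i k. i \<in> I \<Longrightarrow> k \<le> n \<Longrightarrow> norm (B i $ k) \<le> D"
    "\<And>i \<epsilon>. i \<in> I \<Longrightarrow> 0 < \<epsilon> \<Longrightarrow> \<epsilon> \<le> 1 \<Longrightarrow>
        norm (\<psi> i \<epsilon> - (\<Sum>k\<le>n. B i $ k * of_real \<epsilon> ^ k)) \<le> D * \<epsilon> ^ Suc n"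
    using assms(2) by (rule expandsE) (rule that)
  show ?thesis
  proof (rule expandsI[where C = "C + D" and B = "C + D"])
    fix i k assume "i \<in> I" "k \<le> n"
    then show "norm ((A i + B i) $ k) \<le> C + D"
      using C(2)[of i k] D(2)[of i k] norm_triangle_ineq[of "A i $ k" "B i $ k"] by simp
  next
    fix i and \<epsilon> :: real assume *: "i \<in> I" "0 < \<epsilon>" "\<epsilon> \<le> 1"
    have "\<phi> i \<epsilon> + \<psi> i \<epsilon> - (\<Sum>k\<le>n. (A i + B i) $ k * of_real \<epsilon> ^ k) =
      (\<phi> i \<epsilon> - (\<Sum>k\<le>n. A i $ k * of_real \<epsilon> ^ k)) + (\<psi> i \<epsilon> - (\<Sum>k\<le>n. B i $ k * of_real \<epsilon> ^ k))"
      by (simp add: sum.distrib algebra_simps)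
    also have "norm \<dots> \<le> C * \<epsilon> ^ Suc n + D * \<epsilon> ^ Suc n"
      by (intro norm_triangle_le add_mono C D *)
    finally show "norm (\<phi> i \<epsilon> + \<psi> i \<epsilon> - (\<Sum>k\<le>n. (A i + B i) $ k * of_real \<epsilon> ^ k)) \<le> (C + D) * \<epsilon> ^ Suc n"
      by (simp add: algebra_simps)
  qed
qed

text \<open>
  The product of two polynomials of degree n is a sum over a square of index pairs, its truncation
  the sum over the triangle below the antidiagonal; each of the remaining terms has a factor
  \<epsilon>^(n+1).
\<close>
lemma truncated_product_error:
  fixes a b :: "nat \<Rightarrow> 'a::real_normed_field"
  assumes a: "\<And>k. k \<le> n \<Longrightarrow> norm (a k) \<le> C" and b: "\<And>k. k \<le> n \<Longrightarrow> norm (b k) \<le> D"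
    and e: "0 < \<epsilon>" "\<epsilon> \<le> 1" and CD: "C \<ge> 0" "D \<ge> 0"
  shows "norm ((\<Sum>k\<le>n. a k * of_real \<epsilon> ^ k) * (\<Sum>k\<le>n. b k * of_real \<epsilon> ^ k)
            - (\<Sum>k\<le>n. (\<Sum>i\<le>k. a i * b (k - i)) * of_real \<epsilon> ^ k))
         \<le> real ((n + 1)\<^sup>2) * (C * D) * \<epsilon> ^ Suc n"
proof -
  define g where "g = (\<lambda>(i,j). a i * b j * of_real \<epsilon> ^ (i + j))"
  define Q where "Q = {..n} \<times> {..n}"
  define T where "T = {(i::nat,j::nat). i + j \<le> n}"
  have fin: "finite Q" "T \<subseteq> Q" unfolding Q_def T_def by auto
  have 1: "(\<Sum>k\<le>n. a k * of_real \<epsilon> ^ k) * (\<Sum>k\<le>n. b k * of_real \<epsilon> ^ k) = sum g Q"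
    unfolding g_def Q_def sum_product sum.cartesian_product
    by (intro sum.cong) (auto simp: power_add)
  have "sum g T = (\<Sum>k\<le>n. \<Sum>i\<le>k. g (i, k - i))"
    unfolding T_def using sum.triangle_reindex_eq[of "\<lambda>i j. g (i, j)" n] by simp
  also have "\<dots> = (\<Sum>k\<le>n. (\<Sum>i\<le>k. a i * b (k - i)) * of_real \<epsilon> ^ k)"
    by (simp add: g_def sum_distrib_right)
  finally have 2: "(\<Sum>k\<le>n. (\<Sum>i\<le>k. a i * b (k - i)) * of_real \<epsilon> ^ k) = sum g T" ..
  have "norm (sum g Q - sum g T) = norm (sum g (Q - T))"
    using fin by (simp add: sum_diff)
  also have "\<dots> \<le> of_nat (card (Q - T)) * (C * D * \<epsilon> ^ Suc n)"
  proof (rule sum_norm_bound)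
    fix x assume "x \<in> Q - T"
    then obtain i j where x: "x = (i, j)" "i \<le> n" "j \<le> n" "Suc n \<le> i + j"
      unfolding Q_def T_def by auto
    have "norm (g x) = norm (a i) * norm (b j) * \<epsilon> ^ (i + j)"
      using e by (simp add: x g_def norm_mult norm_power)
    also have "\<dots> \<le> C * D * \<epsilon> ^ Suc n"
      using e CD x by (intro mult_mono a b power_decreasing) auto
    finally show "norm (g x) \<le> C * D * \<epsilon> ^ Suc n" .
  qed
  also have "\<dots> \<le> real ((n + 1)\<^sup>2) * (C * D * \<epsilon> ^ Suc n)"
  proof (intro mult_right_mono)
    have "card (Q - T) \<le> card Q" using fin by (intro card_mono) auto
    then show "real (card (Q - T)) \<le> real ((n + 1)\<^sup>2)"
      by (simp add: Q_def power2_eq_square del: of_nat_mult of_nat_add)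
  qed (use CD e in auto)
  finally show ?thesis unfolding 1 2 by (simp add: mult.assoc)
qed

lemma expands_bounded:
  assumes "expands I n A \<phi>"
  obtains C where "C \<ge> 0" "\<And>i \<epsilon>. i \<in> I \<Longrightarrow> 0 < \<epsilon> \<Longrightarrow> \<epsilon> \<le> 1 \<Longrightarrow> norm (\<phi> i \<epsilon>) \<le> C"
proof -
  obtain C where C: "C \<ge> 0" "\<And>i k. i \<in> I \<Longrightarrow> k \<le> n \<Longrightarrow> norm (A i $ k) \<le> C"
    "\<And>i \<epsilon>. i \<in> I \<Longrightarrow> 0 < \<epsilon> \<Longrightarrow> \<epsilon> \<le> 1 \<Longrightarrow>
        norm (\<phi> i \<epsilon> - (\<Sum>k\<le>n. A i $ k * of_real \<epsilon> ^ k)) \<le> C * \<epsilon> ^ Suc n"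
    using assms by (rule expandsE) (rule that)
  show thesis
  proof (rule that[of "C + real (n + 1) * C"])
    fix i and \<epsilon> :: real assume *: "i \<in> I" "0 < \<epsilon>" "\<epsilon> \<le> 1"
    have "norm (\<Sum>k\<le>n. A i $ k * of_real \<epsilon> ^ k) \<le> of_nat (card {..n}) * C"
    proof (rule sum_norm_bound)
      fix k assume "k \<in> {..n}"
      then have "norm (A i $ k) * \<epsilon> ^ k \<le> C * 1"
        using * C by (intro mult_mono power_le_one) auto
      then show "norm (A i $ k * of_real \<epsilon> ^ k) \<le> C"
        using * by (simp add: norm_mult norm_power)
    qed
    moreover have "C * \<epsilon> ^ Suc n \<le> C * 1"
      using * C(1) by (intro mult_left_mono power_le_one) auto
    moreover note C(3)[OF *] norm_triangle_sub[of "\<phi> i \<epsilon>" "\<Sum>k\<le>n. A i $ k * of_real \<epsilon> ^ k"]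
    ultimately show "norm (\<phi> i \<epsilon>) \<le> C + real (n + 1) * C" by simp
  qed (use C in auto)
qed

lemma expands_mult:
  assumes "expands I n A \<phi>" "expands I n B \<psi>"
  shows "expands I n (\<lambda>i. A i * B i) (\<lambda>i \<epsilon>. \<phi> i \<epsilon> * \<psi> i \<epsilon>)"
proof -
  obtain C where C: "C \<ge> 0" "\<And>i k. i \<in> I \<Longrightarrow> k \<le> n \<Longrightarrow> norm (A i $ k) \<le> C"
    "\<And>i \<epsilon>. i \<in> I \<Longrightarrow> 0 < \<epsilon> \<Longrightarrow> \<epsilon> \<le> 1 \<Longrightarrow>
        norm (\<phi> i \<epsilon> - (\<Sum>k\<le>n. A i $ k * of_real \<epsilon> ^ k)) \<le> C * \<epsilon> ^ Suc n"
    using assms(1) by (rule expandsE) (rule that)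
  obtain D where D: "D \<ge> 0" "\<And>i k. i \<in> I \<Longrightarrow> k \<le> n \<Longrightarrow> norm (B i $ k) \<le> D"
    "\<And>i \<epsilon>. i \<in> I \<Longrightarrow> 0 < \<epsilon> \<Longrightarrow> \<epsilon> \<le> 1 \<Longrightarrow>
        norm (\<psi> i \<epsilon> - (\<Sum>k\<le>n. B i $ k * of_real \<epsilon> ^ k)) \<le> D * \<epsilon> ^ Suc n"
    using assms(2) by (rule expandsE) (rule that)
  obtain C' where C': "C' \<ge> 0" "\<And>i \<epsilon>. i \<in> I \<Longrightarrow> 0 < \<epsilon> \<Longrightarrow> \<epsilon> \<le> 1 \<Longrightarrow> norm (\<phi> i \<epsilon>) \<le> C'"
    using assms(1) by (rule expands_bounded) blast
  have "expands I n B (\<lambda>i \<epsilon>. \<Sum>k\<le>n. B i $ k * of_real \<epsilon> ^ k)"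
    using D(2) by (intro expands_polynomial) blast
  then obtain D' where D': "D' \<ge> 0" "\<And>i \<epsilon>. i \<in> I \<Longrightarrow> 0 < \<epsilon> \<Longrightarrow> \<epsilon> \<le> 1 \<Longrightarrow>
      norm (\<Sum>k\<le>n. B i $ k * of_real \<epsilon> ^ k) \<le> D'"
    by (rule expands_bounded) blast
  show ?thesis
  proof (rule expandsI)
    fix i k assume *: "i \<in> I" "k \<le> n"
    have "norm ((A i * B i) $ k) \<le> of_nat (card {0..k}) * (C * D)"
      unfolding fps_mult_nth
      by (rule sum_norm_bound) (use * C D in \<open>auto simp: norm_mult intro!: mult_mono\<close>)
    also have "\<dots> \<le> real (n + 1) * (C * D)"
      using * C(1) D(1) by (intro mult_right_mono) auto
    finally show "norm ((A i * B i) $ k) \<le> real (n + 1) * (C * D)" .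
  next
    fix i and \<epsilon> :: real assume *: "i \<in> I" "0 < \<epsilon>" "\<epsilon> \<le> 1"
    define p where "p = (\<Sum>k\<le>n. A i $ k * of_real \<epsilon> ^ k)"
    define q where "q = (\<Sum>k\<le>n. B i $ k * of_real \<epsilon> ^ k)"
    define r where "r = (\<Sum>k\<le>n. (A i * B i) $ k * of_real \<epsilon> ^ k)"
    have "r = (\<Sum>k\<le>n. (\<Sum>j\<le>k. A i $ j * B i $ (k - j)) * of_real \<epsilon> ^ k)"
      unfolding r_def by (simp add: fps_mult_nth atMost_atLeast0)
    then have pqr: "norm (p * q - r) \<le> real ((n + 1)\<^sup>2) * (C * D) * \<epsilon> ^ Suc n"
      unfolding p_def q_def by (simp only:) (rule truncated_product_error; use * C D in auto)
    have "\<phi> i \<epsilon> * \<psi> i \<epsilon> - r = \<phi> i \<epsilon> * (\<psi> i \<epsilon> - q) + (\<phi> i \<epsilon> - p) * q + (p * q - r)"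
      by (simp add: algebra_simps)
    also have "norm \<dots> \<le> C' * (D * \<epsilon> ^ Suc n) + (C * \<epsilon> ^ Suc n) * D'
        + real ((n + 1)\<^sup>2) * (C * D) * \<epsilon> ^ Suc n"
      unfolding p_def q_def
      using C(3)[OF *] D(3)[OF *] C'(2)[OF *] D'(2)[OF *] pqr C(1) D(1) C'(1) D'(1) *
      by (intro norm_triangle_le add_mono) (auto simp: norm_mult p_def q_def intro!: mult_mono)
    also have "\<dots> = (C' * D + C * D' + real ((n + 1)\<^sup>2) * (C * D)) * \<epsilon> ^ Suc n"
      by (simp add: algebra_simps)
    finally show "norm (\<phi> i \<epsilon> * \<psi> i \<epsilon> - (\<Sum>k\<le>n. (A i * B i) $ k * of_real \<epsilon> ^ k)) \<le>
      (C' * D + C * D' + real ((n + 1)\<^sup>2) * (C * D)) * \<epsilon> ^ Suc n"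
      unfolding r_def .
  qed
qed

lemma expands_power:
  assumes "expands I n A \<phi>"
  shows "expands I n (\<lambda>i. A i ^ k) (\<lambda>i \<epsilon>. \<phi> i \<epsilon> ^ k)"
proof (induction k)
  case 0
  show ?case using expands_const[of I "\<lambda>_. 1" 1 n] by simp
next
  case (Suc k)
  show ?case using expands_mult[OF assms Suc] by simp
qed

lemma expands_minus:
  fixes A :: "'i \<Rightarrow> 'a::real_normed_field fps"
  assumes "expands I n A \<phi>"
  shows "expands I n (\<lambda>i. - A i) (\<lambda>i \<epsilon>. - \<phi> i \<epsilon>)"
proof -
  have "fps_const (-1) * A i = - A i" for i by (simp add: fps_eq_iff)
  then show ?thesis
    using expands_mult[OF expands_const[of I "\<lambda>_. -1" 1 n] assms] by simp
qed

lemma expands_diff: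
  assumes "expands I n A \<phi>" "expands I n B \<psi>"
  shows "expands I n (\<lambda>i. A i - B i) (\<lambda>i \<epsilon>. \<phi> i \<epsilon> - \<psi> i \<epsilon>)"
  using expands_add[OF assms(1) expands_minus[OF assms(2)]] by simp

lemma expands_sum:
  assumes "\<And>k. k \<in> K \<Longrightarrow> expands I n (A k) (\<phi> k)" "finite K"
  shows "expands I n (\<lambda>i. \<Sum>k\<in>K. A k i) (\<lambda>i \<epsilon>. \<Sum>k\<in>K. \<phi> k i \<epsilon>)"
  using assms(2,1)
proof (induction K rule: finite_induct)
  case empty
  show ?case using expands_const[of I "\<lambda>_. 0" 0 n] by simp
next
  case (insert k K)
  then show ?case by (simp add: expands_add)
qed

text \<open>
  How expansions are used: an identity of formal power series through order n becomes a
  uniform bound of order n + 1 for the corresponding combination of functions.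
\<close>
lemma expands_coeff_zero:
  assumes "expands I n A \<phi>" "\<And>i k. i \<in> I \<Longrightarrow> k \<le> n \<Longrightarrow> A i $ k = 0"
  obtains C where "C \<ge> 0"
    "\<And>i \<epsilon>. i \<in> I \<Longrightarrow> 0 < \<epsilon> \<Longrightarrow> \<epsilon> \<le> 1 \<Longrightarrow> norm (\<phi> i \<epsilon>) \<le> C * \<epsilon> ^ Suc n"
  using assms by (elim expandsE) simp

lemma expands_perturb:
  assumes "expands I n A \<psi>"
    "\<And>i \<epsilon>. i \<in> I \<Longrightarrow> 0 < \<epsilon> \<Longrightarrow> \<epsilon> \<le> 1 \<Longrightarrow> norm (\<chi> i \<epsilon> - \<psi> i \<epsilon>) \<le> D * \<epsilon> ^ Suc n"
  shows "expands I n A \<chi>"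
proof -
  obtain C where C: "C \<ge> 0" "\<And>i k. i \<in> I \<Longrightarrow> k \<le> n \<Longrightarrow> norm (A i $ k) \<le> C"
    "\<And>i \<epsilon>. i \<in> I \<Longrightarrow> 0 < \<epsilon> \<Longrightarrow> \<epsilon> \<le> 1 \<Longrightarrow>
        norm (\<psi> i \<epsilon> - (\<Sum>k\<le>n. A i $ k * of_real \<epsilon> ^ k)) \<le> C * \<epsilon> ^ Suc n"
    using assms(1) by (rule expandsE) (rule that)
  show ?thesis
  proof (rule expandsI[OF C(2)])
    fix i and \<epsilon> :: real assume *: "i \<in> I" "0 < \<epsilon>" "\<epsilon> \<le> 1"
    show "norm (\<chi> i \<epsilon> - (\<Sum>k\<le>n. A i $ k * of_real \<epsilon> ^ k)) \<le> (D + C) * \<epsilon> ^ Suc n"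
      using norm_triangle_mono[OF assms(2)[OF *] C(3)[OF *]] by (simp add: algebra_simps)
  qed
qed

lemma expands_small:
  assumes "expands I n A \<phi>" "\<And>i. i \<in> I \<Longrightarrow> A i $ 0 = 0"
  obtains C where "C \<ge> 0" "\<And>i \<epsilon>. i \<in> I \<Longrightarrow> 0 < \<epsilon> \<Longrightarrow> \<epsilon> \<le> 1 \<Longrightarrow> norm (\<phi> i \<epsilon>) \<le> C * \<epsilon>"
proof -
  obtain C where C: "C \<ge> 0" "\<And>i k. i \<in> I \<Longrightarrow> k \<le> n \<Longrightarrow> norm (A i $ k) \<le> C"
    "\<And>i \<epsilon>. i \<in> I \<Longrightarrow> 0 < \<epsilon> \<Longrightarrow> \<epsilon> \<le> 1 \<Longrightarrow>
        norm (\<phi> i \<epsilon> - (\<Sum>k\<le>n. A i $ k * of_real \<epsilon> ^ k)) \<le> C * \<epsilon> ^ Suc n"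
    using assms(1) by (rule expandsE) (rule that)
  show thesis
  proof (rule that[of "C + real (n + 1) * C"])
    fix i and \<epsilon> :: real assume *: "i \<in> I" "0 < \<epsilon>" "\<epsilon> \<le> 1"
    have le: "\<epsilon> ^ Suc k \<le> \<epsilon>" for k using * power_decreasing[of 1 "Suc k" \<epsilon>] by simp
    have "norm (\<Sum>k\<le>n. A i $ k * of_real \<epsilon> ^ k) \<le> of_nat (card {..n}) * (C * \<epsilon>)"
    proof (rule sum_norm_bound)
      fix k assume k: "k \<in> {..n}"
      show "norm (A i $ k * of_real \<epsilon> ^ k) \<le> C * \<epsilon>"
      proof (cases k)
        case 0
        then show ?thesis using assms(2)[OF *(1)] * C(1) by simp
      next
        case (Suc j)
        have "norm (A i $ k) * \<epsilon> ^ k \<le> C * \<epsilon>"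
          unfolding Suc by (intro mult_mono le) (use * C k Suc in auto)
        then show ?thesis using * by (simp add: norm_mult norm_power)
      qed
    qed
    moreover have "C * \<epsilon> ^ Suc n \<le> C * \<epsilon>"
      using C(1) le by (intro mult_left_mono) auto
    moreover note C(3)[OF *] norm_triangle_sub[of "\<phi> i \<epsilon>" "\<Sum>k\<le>n. A i $ k * of_real \<epsilon> ^ k"]
    ultimately show "norm (\<phi> i \<epsilon>) \<le> (C + real (n + 1) * C) * \<epsilon>" by (simp add: algebra_simps)
  qed (use C in auto)
qed

section \<open>The coefficients as polynomials in one variable\<close>

text \<open>
  Put w = 1/(1 + \<i>\<theta>). The integral of t^(a-1) e^(it) over [0, a\<theta>] equals
  (a\<theta>)^a e^(\<i>a\<theta>) w K / a, where the factor K tends to 1 as a grows, and 1/K has the expansion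
  with coefficients recip_coeff n, evaluated at w, in powers of 1/a. The recursion is the Riccati
  equation of 1/K, obtained from the differential equation of the integral, and by
  lemma F_minus_eq it is also the recursion that defines F_minus.
\<close>
fun recip_coeff :: "nat \<Rightarrow> complex poly" where
  "recip_coeff 0 = 1"
| "recip_coeff (Suc 0) = [:0, -1, 1:]"
| "recip_coeff (Suc (Suc n)) = - [:0, 0, -1, 1:] * pderiv (recip_coeff (Suc n))
     - (\<Sum>j\<in>{2..Suc n}. recip_coeff j * recip_coeff (Suc (Suc n) - j))"

text \<open>
  The factor K tends to 1 as \<theta> tends to 0 (where w = 1) and to infinity (where w = 0), so all
  corrections vanish at both points.
\<close>
lemma recip_coeff_dvd1: "[:0, -1, 1:] dvd recip_coeff (Suc n)"
proof (induction n rule: less_induct)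
  case (less n)
  show ?case
  proof (cases n)
    case (Suc k)
    have "[:0, -1, 1:] dvd recip_coeff j * recip_coeff (Suc (Suc k) - j)" if "j \<in> {2..Suc k}" for j
      using less.IH[of "j - 1"] that Suc by (auto intro: dvd_mult2)
    moreover have "[:0, -1, 1:] dvd - [:0, 0, -1, 1:] * pderiv (recip_coeff (Suc k))"
    proof -
      have "- [:0, 0, -1, 1:] = [:0, -1, 1:] * ([:0, -1:] :: complex poly)" by simp
      then show ?thesis by (metis dvd_mult2 dvd_triv_left)
    qed
    ultimately show ?thesis unfolding Suc recip_coeff.simps by (intro dvd_diff dvd_sum) auto
  qed simp
qed

text \<open>
  In terms of w the integral of E_minus has the integrand recip_coeff (s + 1) / (w^2 (w - 1)), up to a
  sign. The extra factor w makes it a polynomial, which is why E_minus has no logarithms.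
\<close>
lemma recip_coeff_dvd2: "[:0, 0, -1, 1:] dvd recip_coeff (Suc (Suc n))"
proof -
  have "[:0, 0, -1, 1:] dvd recip_coeff j * recip_coeff (Suc (Suc n) - j)" if "j \<in> {2..Suc n}" for j
  proof -
    have "[:0, -1, 1:] * [:0, -1, 1:] dvd recip_coeff j * recip_coeff (Suc (Suc n) - j)"
      using recip_coeff_dvd1[of "j - 1"] recip_coeff_dvd1[of "Suc n - j"] that
      by (intro mult_dvd_mono) (auto simp: Suc_diff_le)
    moreover have "[:0, -1, 1:] * [:0, -1, 1:] = [:0, 0, -1, 1:] * ([:-1, 1:] :: complex poly)" by simp
    ultimately show ?thesis by (metis dvd_mult_left)
  qed
  moreover have "[:0, 0, -1, 1:] dvd - [:0, 0, -1, 1:] * pderiv (recip_coeff (Suc n))"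
    by (rule dvd_mult2) (simp only: dvd_minus_iff dvd_refl)
  ultimately show ?thesis unfolding recip_coeff.simps by (intro dvd_diff dvd_sum)
qed

lemma pderiv_surj:
  fixes Q :: "'a::field_char_0 poly"
  shows "\<exists>P. pderiv P = Q \<and> poly P c = 0"
proof -
  define P where "P = (\<Sum>i\<le>degree Q. monom (coeff Q i / of_nat (Suc i)) (Suc i))"
  have "pderiv P = (\<Sum>i\<le>degree Q. monom (coeff Q i) i)"
    unfolding P_def by (simp add: higher_pderiv_sum[of 1, simplified] pderiv_monom del: of_nat_Suc)
  also have "\<dots> = Q" by (rule poly_as_sum_of_monoms)
  finally have "pderiv (P - [:poly P c:]) = Q" by (simp add: pderiv_diff)
  then show ?thesis by (intro exI[of _ "P - [:poly P c:]"]) simp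
qed

text \<open>
  The polynomials in w whose values are the coefficients of the logarithm of K in powers of 1/a,
  see the lemma recip_log_derivative. Vanishing at w = 1 corresponds to E_minus s 0 = 0.
\<close>
definition phase_coeff :: "nat \<Rightarrow> complex poly" where
  "phase_coeff s = (SOME P. pderiv P = recip_coeff (Suc s) div [:0, 0, -1, 1:] \<and> poly P 1 = 0)"

lemma phase_coeff:
  "pderiv (phase_coeff s) = recip_coeff (Suc s) div [:0, 0, -1, 1:]" "poly (phase_coeff s) 1 = 0"
  using someI_ex[OF pderiv_surj[of "recip_coeff (Suc s) div [:0, 0, -1, 1:]" 1]]
  unfolding phase_coeff_def by auto

lemma pderiv_phase_coeff:
  "s \<ge> 1 \<Longrightarrow> [:0, 0, -1, 1:] * pderiv (phase_coeff s) = recip_coeff (Suc s)"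
  using recip_coeff_dvd2[of "s - 1"] unfolding phase_coeff(1) by (intro dvd_mult_div_cancel) simp

lemma DERIV_poly_cayley:
  fixes z :: complex
  assumes "z \<noteq> 1"
  shows "((\<lambda>z. c * poly p (1 / (1 - z))) has_field_derivative
           c * (poly (pderiv p) (1 / (1 - z)) * (1 / (1 - z))\<^sup>2)) (at z within S)"
  by (intro DERIV_cmult DERIV_chain2[OF poly_DERIV])
    (use assms in \<open>auto intro!: derivative_eq_intros simp: power2_eq_square divide_simps\<close>)

text \<open>
  The normalization that turns coefficients of 1/K into F_minus; the powers of -1 come
  from z = -\<i>\<theta>, and the exceptional value at s = 0 is the reason why F_minus 1 has to be prescribed
  separately.
\<close>
definition F_sign :: "nat \<Rightarrow> complex" where
  "F_sign s = (if s = 0 then -1 else - 2 * (-1) ^ s)"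

text \<open>
  With w = 1/(1 - z) one has dw/dz = w^2 and z/(1 - z) = w - 1, so that the recursion of F_minus
  turns into a recursion for polynomials in w. The terms j = 0 and j = s of the convolution, which
  contain the exceptional F_minus 0, have to be split off.
\<close>
lemma F_minus_eq:
  "z \<noteq> 1 \<Longrightarrow> F_minus s z = F_sign s * poly (recip_coeff (Suc s)) (1 / (1 - z))"
proof (induction s arbitrary: z rule: less_induct)
  case (less s)
  define w where "w = 1 / (1 - z)"
  have z: "z = 1 - 1 / w" and w0: "w \<noteq> 0" using less.prems by (auto simp: w_def)
  consider "s = 0" | "s = 1" | k where "s = Suc (Suc k)" by (metis One_nat_def not0_implies_Suc)
  then show ?case
  proof cases
    case 1
    show ?thesis unfolding w_def[symmetric] unfolding z using w0 1
      by (simp add: F_sign_def field_simps power2_eq_square)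
  next
    case 2
    show ?thesis unfolding w_def[symmetric] unfolding z using w0 2
      by (simp add: F_sign_def field_simps eval_nat_numeral pderiv_pCons)
  next
    case 3
    let ?m = recip_coeff
    define S where "S = (\<Sum>j\<in>{2..Suc k}. poly (?m j) w * poly (?m (Suc (Suc (Suc k)) - j)) w)"
    have "deriv (F_minus (Suc k)) z = F_sign (Suc k) * (poly (pderiv (?m (Suc (Suc k)))) w * w\<^sup>2)"
    proof (rule DERIV_imp_deriv)
      have "((\<lambda>z. F_sign (Suc k) * poly (?m (Suc (Suc k))) (1 / (1 - z))) has_field_derivative
         F_sign (Suc k) * (poly (pderiv (?m (Suc (Suc k)))) w * w\<^sup>2)) (at z)"
        unfolding w_def using less.prems by (rule DERIV_poly_cayley)
      then show "(F_minus (Suc k) has_field_derivative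
         F_sign (Suc k) * (poly (pderiv (?m (Suc (Suc k)))) w * w\<^sup>2)) (at z)"
      proof (rule DERIV_cong_ev[THEN iffD1, rotated -1])
        have "\<forall>\<^sub>F x in nhds z. x \<noteq> 1" using less.prems by (rule t1_space_nhds)
        then show "\<forall>\<^sub>F x in nhds z. F_sign (Suc k) * poly (?m (Suc (Suc k))) (1 / (1 - x)) = F_minus (Suc k) x"
          by eventually_elim (use less.IH[of "Suc k"] 3 in simp)
      qed auto
    qed
    moreover have "(\<Sum>j\<in>{0..Suc k}. F_minus j z * F_minus (Suc k - j) z) =
       4 * (-1) ^ Suc k * (poly (?m 1) w * poly (?m (Suc (Suc k))) w +
         (\<Sum>j\<in>{1..k}. poly (?m (Suc j)) w * poly (?m (Suc (Suc k - j))) w))"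
    proof -
      have "(\<Sum>j\<in>{0..Suc k}. F_minus j z * F_minus (Suc k - j) z) =
        (\<Sum>j\<in>{0..Suc k}. (F_sign j * poly (?m (Suc j)) w) * (F_sign (Suc k - j) * poly (?m (Suc (Suc k - j))) w))"
        using less.IH[of _ z] less.prems 3 by (intro sum.cong refl) (simp add: w_def)
      also have "\<dots> = 2 * (2 * (-1) ^ Suc k * (poly (?m 1) w * poly (?m (Suc (Suc k))) w)) +
        (\<Sum>j\<in>{1..k}. (F_sign j * poly (?m (Suc j)) w) * (F_sign (Suc k - j) * poly (?m (Suc (Suc k - j))) w))"
        by (subst sum.atLeast_Suc_atMost, simp, subst sum.nat_ivl_Suc') (auto simp: F_sign_def algebra_simps)
      also have "(\<Sum>j\<in>{1..k}. (F_sign j * poly (?m (Suc j)) w) * (F_sign (Suc k - j) * poly (?m (Suc (Suc k - j))) w)) =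
        4 * (-1) ^ Suc k * (\<Sum>j\<in>{1..k}. poly (?m (Suc j)) w * poly (?m (Suc (Suc k - j))) w)"
        unfolding sum_distrib_left
      proof (intro sum.cong refl)
        fix j assume "j \<in> {1..k}"
        then have "(-1) ^ Suc k = (-1) ^ j * (-1 :: complex) ^ (Suc k - j)"
          by (simp flip: power_add)
        with \<open>j \<in> {1..k}\<close> show "F_sign j * poly (?m (Suc j)) w * (F_sign (Suc k - j) * poly (?m (Suc (Suc k - j))) w) =
          4 * (- 1) ^ Suc k * (poly (?m (Suc j)) w * poly (?m (Suc (Suc k - j))) w)"
          by (auto simp: F_sign_def)
      qed
      finally show ?thesis by (simp add: algebra_simps)
    qed
    ultimately have "F_minus s z = z / (1 - z) * (F_sign (Suc k) * (poly (pderiv (?m (Suc (Suc k)))) w * w\<^sup>2))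
       - 2 * (-1) ^ Suc k * (poly (?m 1) w * poly (?m (Suc (Suc k))) w +
         (\<Sum>j\<in>{1..k}. poly (?m (Suc j)) w * poly (?m (Suc (Suc k - j))) w))"
      unfolding 3 F_minus.simps by simp
    also have "z / (1 - z) = w - 1" using less.prems by (simp add: w_def field_simps)
    also have "(\<Sum>j\<in>{1..k}. poly (?m (Suc j)) w * poly (?m (Suc (Suc k - j))) w) =
        (\<Sum>j\<in>{2..Suc k}. poly (?m j) w * poly (?m (Suc (Suc (Suc k)) - j)) w)"
      by (rule sum.reindex_bij_witness[of _ "\<lambda>j. j - 1" Suc]) (auto simp: Suc_diff_le)
    also note S_def[symmetric]
    finally have F: "F_minus s z = (w - 1) * (F_sign (Suc k) * (poly (pderiv (?m (Suc (Suc k)))) w * w\<^sup>2)) -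
      2 * (- 1) ^ Suc k * (poly (?m 1) w * poly (?m (Suc (Suc k))) w +
      S)" .
    have "poly (?m (Suc s)) w = - (w\<^sup>2 * (w - 1)) * poly (pderiv (?m (Suc (Suc k)))) w -
        (\<Sum>j\<in>{2..Suc (Suc k)}. poly (?m j) w * poly (?m (Suc (Suc (Suc k)) - j)) w)"
      unfolding 3 recip_coeff.simps(3)[of "Suc k"]
      by (simp add: poly_sum power2_eq_square algebra_simps del: recip_coeff.simps)
    also have "(\<Sum>j\<in>{2..Suc (Suc k)}. poly (?m j) w * poly (?m (Suc (Suc (Suc k)) - j)) w) =
        poly (?m (Suc (Suc k))) w * poly (?m 1) w +
       S"
      unfolding S_def by (subst sum.nat_ivl_Suc') (auto simp del: recip_coeff.simps)
    finally have m: "poly (?m (Suc s)) w = - (w\<^sup>2 * (w - 1)) * poly (pderiv (?m (Suc (Suc k)))) w -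
        (poly (?m (Suc (Suc k))) w * poly (?m 1) w + S)" .
    show ?thesis unfolding w_def[symmetric] F m
      by (simp add: F_sign_def 3 algebra_simps del: recip_coeff.simps)
  qed
qed

text \<open>
  The factor (t - 1)/(2t) cancels the factor w - 1 = t/(1 - t) of F_minus, which leaves the derivative
  of a polynomial in w = 1/(1 - t). This primitive extends the integrand across t = 0.
\<close>
lemma E_minus_eq:
  assumes "s \<ge> 1" "\<And>u. u \<in> {0..1} \<Longrightarrow> of_real u * z \<noteq> 1"
  shows "E_minus s z = (-1) ^ s * poly (phase_coeff s) (1 / (1 - z))"
proof -
  define q where "q = pderiv (phase_coeff s)"
  define g where "g = (\<lambda>t. (-1) ^ s * poly (phase_coeff s) (1 / (1 - t)))"
  define g' where "g' = (\<lambda>t. (-1) ^ s * (poly q (1 / (1 - t)) * (1 / (1 - t))\<^sup>2))"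
  have ne: "t \<noteq> 1" if "t \<in> path_image (linepath 0 z)" for t
    using assms(2) that by (auto simp: linepath_def path_image_def scaleR_conv_of_real)
  have "(g' has_contour_integral (g (pathfinish (linepath 0 z)) - g (pathstart (linepath 0 z)))) (linepath 0 z)"
  proof (rule contour_integral_primitive)
    fix t assume "t \<in> path_image (linepath 0 z)"
    then have "t \<noteq> 1" by (rule ne)
    then show "(g has_field_derivative g' t) (at t within path_image (linepath 0 z))"
      unfolding g_def g'_def q_def by (rule DERIV_poly_cayley)
  qed (rule valid_path_linepath, rule order_refl)
  then have "(g' has_contour_integral g z) (linepath 0 z)"
    by (simp add: g_def phase_coeff(2))
  then have "((\<lambda>x. g' (linepath 0 z x) * z) has_integral g z) {0..1}"
    unfolding has_contour_integral_linepath by simp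
  moreover have "g' t * z = (t - 1) * F_minus s t / (2 * t) * z"
    if t: "t = linepath 0 z x" and x: "x \<in> {0..1} - {0}" for t x
  proof (cases "z = 0")
    case False
    have "t \<in> path_image (linepath 0 z)" unfolding path_image_def t using x by (intro imageI) auto
    then have "t \<noteq> 1" by (rule ne)
    moreover have "t \<noteq> 0" using False t x by (auto simp: linepath_def)
    ultimately show ?thesis
      using \<open>s \<ge> 1\<close> unfolding F_minus_eq[OF \<open>t \<noteq> 1\<close>] pderiv_phase_coeff[OF \<open>s \<ge> 1\<close>, symmetric] g'_def q_def
      by (simp add: F_sign_def divide_simps power2_eq_square) (simp add: algebra_simps)
  qed simp
  ultimately have "((\<lambda>x. (linepath 0 z x - 1) * F_minus s (linepath 0 z x) / (2 * linepath 0 z x) * z)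
      has_integral g z) {0..1}"
    by (subst (asm) has_integral_spike_finite_eq[of "{0}"]) auto
  then have "((\<lambda>t. (t - 1) * F_minus s t / (2 * t)) has_contour_integral g z) (linepath 0 z)"
    unfolding has_contour_integral_linepath by simp
  then show ?thesis unfolding E_minus_def g_def by (rule contour_integral_unique)
qed

text \<open>
  The value of 1/(1 - z) at z = -\<i>\<theta>. It lies in the closed unit disc for every real \<theta>; estimates
  that are uniform in w on the disc are thus uniform in \<theta>.
\<close>
definition cw :: "real \<Rightarrow> complex" where
  "cw \<theta> = 1 / (1 + \<i> * of_real \<theta>)"

lemma L_coeff_eq: "s \<ge> 1 \<Longrightarrow> L_coeff s \<theta> = Im (poly (phase_coeff s) (cw \<theta>))"
proof -
  assume s: "s \<ge> 1"
  have "of_real u * (- \<i> * of_real \<theta>) \<noteq> 1" for u :: real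
    by (auto simp: complex_eq_iff)
  then have "L_coeff s \<theta> = (-1) ^ s * Im ((-1) ^ s * poly (phase_coeff s) (cw \<theta>))"
    unfolding L_coeff_def by (subst E_minus_eq[OF s]) (auto simp: cw_def)
  also have "\<dots> = Im (poly (phase_coeff s) (cw \<theta>))"
    by (cases "even s") auto
  finally show ?thesis .
qed

section \<open>Functions with bounded derivatives\<close>

lemma Re_cw: "Re (cw \<theta>) = 1 / (1 + \<theta>\<^sup>2)" and Im_cw: "Im (cw \<theta>) = - \<theta> / (1 + \<theta>\<^sup>2)"
  and cw_nonzero: "cw \<theta> \<noteq> 0" and inverse_cw: "1 / cw \<theta> = 1 + \<i> * of_real \<theta>"
  and cw_minus_1: "cw \<theta> - 1 = - \<i> * of_real \<theta> * cw \<theta>"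
proof -
  have nz: "1 + \<i> * of_real \<theta> \<noteq> 0" by (simp add: complex_eq_iff)
  show "Re (cw \<theta>) = 1 / (1 + \<theta>\<^sup>2)" "Im (cw \<theta>) = - \<theta> / (1 + \<theta>\<^sup>2)"
    by (simp_all add: cw_def Re_divide Im_divide power2_eq_square)
  show "cw \<theta> \<noteq> 0" "1 / cw \<theta> = 1 + \<i> * of_real \<theta>" "cw \<theta> - 1 = - \<i> * of_real \<theta> * cw \<theta>"
    using nz by (simp_all add: cw_def field_simps)
qed

lemma norm_cw: "norm (cw \<theta>) = 1 / sqrt (1 + \<theta>\<^sup>2)"
  unfolding cw_def norm_divide by (simp add: cmod_def)

lemma norm_cw_le_1: "norm (cw \<theta>) \<le> 1"
proof -
  have "1 \<le> sqrt (1 + \<theta>\<^sup>2)" by simp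
  then show ?thesis unfolding norm_cw by (simp add: divide_le_eq_1 add_pos_nonneg)
qed

text \<open>
  Differentiation with respect to \<theta>, transported to polynomials in w by dw/d\<theta> = -\<i>w^2.
\<close>
definition cw_deriv :: "complex poly \<Rightarrow> complex poly" where
  "cw_deriv A = [:0, 0, -\<i>:] * pderiv A"

lemma poly_cw_has_vector_derivative:
  "((\<lambda>\<theta>. poly A (cw \<theta>)) has_vector_derivative poly (cw_deriv A) (cw \<theta>)) (at \<theta> within S)"
proof -
  have nz: "1 + \<i> * of_real \<theta> \<noteq> 0" by (simp add: complex_eq_iff)
  have "((\<lambda>z. poly A (1 / (1 + \<i> * z))) has_field_derivative
      poly (pderiv A) (cw \<theta>) * (- \<i> * (cw \<theta>)\<^sup>2)) (at (of_real \<theta>))"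
    unfolding cw_def
    by (intro DERIV_chain2[OF poly_DERIV])
      (use nz in \<open>auto intro!: derivative_eq_intros simp: power2_eq_square divide_simps\<close>)
  from has_vector_derivative_real_field[OF this]
  show ?thesis
    by (simp add: cw_def cw_deriv_def power2_eq_square algebra_simps)
qed

lemma poly_bounded_on_disc:
  fixes p :: "complex poly"
  obtains C where "C \<ge> 0" "\<And>w. norm w \<le> 1 \<Longrightarrow> norm (poly p w) \<le> C"
proof -
  have "bounded (poly p ` cball 0 1)"
    by (intro compact_imp_bounded compact_continuous_image continuous_intros compact_cball)
  then obtain C where "\<And>w. norm w \<le> 1 \<Longrightarrow> norm (poly p w) \<le> C"
    unfolding bounded_iff by (metis imageI mem_cball_0)
  then show thesis by (intro that[of "max C 0"]) (auto simp: le_max_iff_disj)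
qed

text \<open>
  The functions into which an expansion can be substituted with a uniform error.
\<close>
definition bounded_derivs :: "(real \<Rightarrow> real) \<Rightarrow> bool" where
  "bounded_derivs f \<longleftrightarrow>
     (\<forall>n. (\<exists>C. \<forall>x. \<bar>(deriv ^^ n) f x\<bar> \<le> C) \<and>
          (\<forall>x. ((deriv ^^ n) f has_real_derivative (deriv ^^ Suc n) f x) (at x)))"

lemma Im_poly_cw_deriv:
  "((\<lambda>\<theta>. Im (poly A (cw \<theta>))) has_real_derivative Im (poly (cw_deriv A) (cw \<theta>))) (at \<theta>)"
  unfolding has_real_derivative_iff_has_vector_derivative
  by (intro bounded_linear.has_vector_derivative[OF bounded_linear_Im] poly_cw_has_vector_derivative)

text \<open>
  All derivatives of L_coeff s and of arctan are again of the form Im (A(w)) with a polynomial A, and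
  w stays in the unit disc. This is the source of all bounds that are uniform in \<theta>.
\<close>
lemma Im_poly_cw_derivs:
  "(deriv ^^ n) (\<lambda>\<theta>. Im (poly A (cw \<theta>))) = (\<lambda>\<theta>. Im (poly ((cw_deriv ^^ n) A) (cw \<theta>)))"
  by (induction n) (auto intro: DERIV_imp_deriv Im_poly_cw_deriv)

lemma Im_poly_cw_bounded: "\<exists>C. \<forall>\<theta>. \<bar>Im (poly A (cw \<theta>))\<bar> \<le> C"
proof -
  obtain C where "\<And>w. norm w \<le> 1 \<Longrightarrow> norm (poly A w) \<le> C" by (rule poly_bounded_on_disc) (rule that)
  then show ?thesis by (meson abs_Im_le_cmod norm_cw_le_1 order_trans)
qed

lemma bounded_derivs_Im_poly_cw: "bounded_derivs (\<lambda>\<theta>. Im (poly A (cw \<theta>)))"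
  unfolding bounded_derivs_def Im_poly_cw_derivs
  using Im_poly_cw_bounded Im_poly_cw_deriv by simp

lemma bounded_derivs_L_coeff: "s \<ge> 1 \<Longrightarrow> bounded_derivs (L_coeff s)"
proof -
  assume "s \<ge> 1"
  then have "L_coeff s = (\<lambda>\<theta>. Im (poly (phase_coeff s) (cw \<theta>)))" by (auto simp: L_coeff_eq)
  then show ?thesis by (simp add: bounded_derivs_Im_poly_cw)
qed

lemma abs_arctan_le: "\<bar>arctan x\<bar> \<le> pi / 2"
  using arctan_lbound[of x] arctan_ubound[of x] by linarith

text \<open>
  The derivative of arctan is the real part of w, that is, Im (\<i>w).
\<close>
lemma bounded_derivs_arctan: "bounded_derivs arctan"
proof -
  define g where "g = (\<lambda>\<theta>. Im (poly [:0, \<i>:] (cw \<theta>)))"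
  have g: "g x = inverse (1 + x\<^sup>2)" for x by (simp add: g_def Re_cw inverse_eq_divide)
  have 1: "deriv arctan = g"
    by (rule ext, rule DERIV_imp_deriv) (use DERIV_arctan in \<open>simp add: g\<close>)
  then have 2: "(deriv ^^ Suc n) arctan = (deriv ^^ n) g" for n
    by (simp add: funpow_Suc_right del: funpow.simps)
  have g': "bounded_derivs g" unfolding g_def by (rule bounded_derivs_Im_poly_cw)
  show ?thesis
    unfolding bounded_derivs_def
  proof
    fix n
    show "(\<exists>C. \<forall>x. \<bar>(deriv ^^ n) arctan x\<bar> \<le> C) \<and>
         (\<forall>x. ((deriv ^^ n) arctan has_real_derivative (deriv ^^ Suc n) arctan x) (at x))"
    proof (cases n)
      case 0
      have "\<exists>C. \<forall>x. \<bar>arctan x\<bar> \<le> C" using abs_arctan_le by blast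
      then show ?thesis using 0 DERIV_arctan g 1 by simp
    next
      case (Suc k)
      show ?thesis using g' unfolding bounded_derivs_def Suc 2 by blast
    qed
  qed
qed

lemma bounded_derivs_lipschitz:
  assumes "bounded_derivs f"
  obtains C where "C \<ge> 0" "\<And>u v. \<bar>f u - f v\<bar> \<le> C * \<bar>u - v\<bar>"
proof -
  obtain C where C: "\<And>x. \<bar>(deriv ^^ 1) f x\<bar> \<le> C"
    using assms unfolding bounded_derivs_def by meson
  have d: "(f has_real_derivative deriv f x) (at x)" for x
    using assms[unfolded bounded_derivs_def, rule_format, of 0] by simp
  show thesis
  proof (rule that)
    show "0 \<le> C" using C[of 0] by linarith
    show "\<bar>f u - f v\<bar> \<le> C * \<bar>u - v\<bar>" for u v
      using field_differentiable_bound[of UNIV f "deriv f" C u v] C d by auto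
  qed
qed

lemma bounded_derivs_taylor:
  assumes "bounded_derivs f"
  obtains C where "C \<ge> 0"
    "\<And>x u. \<bar>f (x + u) - (\<Sum>k\<le>n. (deriv ^^ k) f x / fact k * u ^ k)\<bar> \<le> C * \<bar>u\<bar> ^ Suc n"
proof -
  obtain C where C: "\<And>x. \<bar>(deriv ^^ Suc n) f x\<bar> \<le> C"
    using assms unfolding bounded_derivs_def by meson
  have d: "((deriv ^^ m) f has_real_derivative (deriv ^^ Suc m) f x) (at x)" for m x
    using assms unfolding bounded_derivs_def by blast
  have C0: "C \<ge> 0" using C[of 0] by linarith
  show thesis
  proof (rule that[OF C0])
    fix x u :: real
    have "((\<lambda>v. (deriv ^^ m) f (x + v)) has_real_derivative (deriv ^^ Suc m) f (x + v)) (at v)" for m v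
      using DERIV_shift[of "(deriv ^^ m) f" "(deriv ^^ Suc m) f (x + v)" v x] d[of m "x + v"]
      by (simp add: add.commute)
    then obtain t where t: "f (x + u) = (\<Sum>m<Suc n. (deriv ^^ m) f (x + 0) / fact m * u ^ m)
        + (deriv ^^ Suc n) f (x + t) / fact (Suc n) * u ^ Suc n"
      using Maclaurin_all_le[of "\<lambda>m v. (deriv ^^ m) f (x + v)" "\<lambda>v. f (x + v)" u "Suc n"]
      by (auto simp del: funpow.simps(2))
    have "\<bar>f (x + u) - (\<Sum>k\<le>n. (deriv ^^ k) f x / fact k * u ^ k)\<bar> =
        \<bar>(deriv ^^ Suc n) f (x + t)\<bar> / fact (Suc n) * \<bar>u\<bar> ^ Suc n"
      unfolding t lessThan_Suc_atMost by (simp add: abs_mult power_abs del: funpow.simps fact_Suc power_Suc)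
    also have "\<dots> \<le> C / 1 * \<bar>u\<bar> ^ Suc n"
      by (intro mult_right_mono frac_le C C0) (auto simp del: fact_Suc)
    finally show "\<bar>f (x + u) - (\<Sum>k\<le>n. (deriv ^^ k) f x / fact k * u ^ k)\<bar> \<le> C * \<bar>u\<bar> ^ Suc n" by simp
  qed
qed

section \<open>The formal series for the zeros\<close>

lemma fps_subst_nth:
  "fps_subst f T $ n = (\<Sum>k\<le>n. (deriv ^^ k) f (T $ 0) / fact k * ((T - fps_const (T $ 0)) ^ k $ n))"
  by (simp add: fps_subst_def fps_compose_nth atMost_atLeast0)

text \<open>
  The formal counterpart of Taylor expansion: fps_subst f (x + h x) is the
  Taylor series of f at x with h x substituted. The base point x itself may be unbounded, and only
  the increment h x has an expansion with bounded coefficients.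
\<close>
lemma expands_fps_subst:
  assumes f: "bounded_derivs f" and h: "expands UNIV n h \<phi>" and h0: "\<And>x. h x $ 0 = 0"
  shows "expands UNIV n (\<lambda>x. fps_subst f (fps_const x + h x)) (\<lambda>x \<epsilon>. f (x + \<phi> x \<epsilon>))"
proof -
  let ?c = "\<lambda>k x. (deriv ^^ k) f x / fact k"
  have "expands UNIV n (\<lambda>x. \<Sum>k\<in>{..n}. fps_const (?c k x) * h x ^ k) (\<lambda>x \<epsilon>. \<Sum>k\<in>{..n}. ?c k x * \<phi> x \<epsilon> ^ k)"
  proof (intro expands_sum expands_mult expands_power h)
    fix k
    obtain C where "\<And>x. \<bar>(deriv ^^ k) f x\<bar> \<le> C" using f unfolding bounded_derivs_def by meson
    then show "expands UNIV n (\<lambda>x. fps_const (?c k x)) (\<lambda>x \<epsilon>. ?c k x)"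
      by (intro expands_const[where C = "C / fact k"]) (auto intro: divide_right_mono)
  qed auto
  then have 1: "expands UNIV n (\<lambda>x. fps_subst f (fps_const x + h x)) (\<lambda>x \<epsilon>. \<Sum>k\<le>n. ?c k x * \<phi> x \<epsilon> ^ k)"
  proof (rule expands_cong)
    fix x m assume m: "m \<le> n"
    have "fps_subst f (fps_const x + h x) $ m = (\<Sum>k\<le>m. ?c k x * (h x ^ k $ m))"
      by (simp add: fps_subst_nth h0)
    also have "\<dots> = (\<Sum>k\<le>n. ?c k x * (h x ^ k $ m))"
      by (rule sum.mono_neutral_left) (use m h0 startsby_zero_power_prefix[of "h x"] in auto)
    finally show "fps_subst f (fps_const x + h x) $ m = (\<Sum>k\<in>{..n}. fps_const (?c k x) * h x ^ k) $ m"
      by (simp add: fps_sum_nth)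
  qed auto
  obtain D where D: "D \<ge> 0" "\<And>x \<epsilon>. 0 < \<epsilon> \<Longrightarrow> \<epsilon> \<le> 1 \<Longrightarrow> norm (\<phi> x \<epsilon>) \<le> D * \<epsilon>"
    using expands_small[OF h] h0 by auto
  obtain E where E: "E \<ge> 0"
    "\<And>x u. \<bar>f (x + u) - (\<Sum>k\<le>n. ?c k x * u ^ k)\<bar> \<le> E * \<bar>u\<bar> ^ Suc n"
    using f by (rule bounded_derivs_taylor) (rule that)
  show ?thesis
  proof (rule expands_perturb[OF 1])
    fix x \<epsilon> :: real assume e: "0 < \<epsilon>" "\<epsilon> \<le> 1"
    have "\<bar>\<phi> x \<epsilon>\<bar> ^ Suc n \<le> (D * \<epsilon>) ^ Suc n" using D(2)[OF e, of x] by (intro power_mono) auto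
    then have "E * \<bar>\<phi> x \<epsilon>\<bar> ^ Suc n \<le> E * (D * \<epsilon>) ^ Suc n" using E(1) by (intro mult_left_mono)
    also have "\<dots> = (E * D ^ Suc n) * \<epsilon> ^ Suc n" by (simp add: power_mult_distrib)
    finally show "norm (f (x + \<phi> x \<epsilon>) - (\<Sum>k\<le>n. ?c k x * \<phi> x \<epsilon> ^ k)) \<le> (E * D ^ Suc n) * \<epsilon> ^ Suc n"
      using E(2)[of x "\<phi> x \<epsilon>"] by simp
  qed
qed

text \<open>
  The sum converges X-adically, because only the summands with s < n contribute to the coefficient
  of X^n.
\<close>
lemma fps_nth_suminf_X_power:
  fixes A :: "nat \<Rightarrow> 'a::comm_ring_1 fps"
  shows "(\<Sum>s. A s * fps_X ^ Suc s) $ n = (\<Sum>s<n. A s $ (n - Suc s))"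
proof -
  have nth: "(A s * fps_X ^ Suc s) $ k = (if k < Suc s then 0 else A s $ (k - Suc s))" for s k
    by (rule fps_X_power_mult_right_nth)
  have "(\<lambda>s. A s * fps_X ^ Suc s) sums Abs_fps (\<lambda>k. \<Sum>s<k. A s $ (k - Suc s))"
    unfolding sums_def
  proof (rule tendsto_fpsI)
    fix k
    show "\<forall>\<^sub>F m in sequentially. (\<Sum>s<m. A s * fps_X ^ Suc s) $ k =
        Abs_fps (\<lambda>k. \<Sum>s<k. A s $ (k - Suc s)) $ k"
      using eventually_ge_at_top[of k]
    proof eventually_elim
      case (elim m)
      have "(\<Sum>s<m. A s * fps_X ^ Suc s) $ k = (\<Sum>s<m. if k < Suc s then 0 else A s $ (k - Suc s))"
        by (simp only: fps_sum_nth nth)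
      also have "\<dots> = (\<Sum>s<k. if k < Suc s then 0 else A s $ (k - Suc s))"
        by (rule sum.mono_neutral_right) (use elim in auto)
      finally show ?case by simp
    qed
  qed
  then show ?thesis by (simp add: sums_iff del: power_Suc)
qed

text \<open>
  The defining identity of the formal series, multiplied by X = 1/a and solved for
  the linear term.
\<close>
definition theta_step :: "real \<Rightarrow> real fps \<Rightarrow> real fps" where
  "theta_step x T = fps_const x + fps_X * (fps_subst arctan T - fps_const (arctan x)
     - (\<Sum>s. fps_subst (L_coeff (Suc s)) T * fps_X ^ Suc s))"

lemma theta_identity_iff_fixpoint: "theta_identity x T \<longleftrightarrow> T = theta_step x T"
proof -
  define U where "U = fps_subst arctan T"
  define S where "S = (\<Sum>s. fps_subst (L_coeff (Suc s)) T * fps_X ^ Suc s)"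
  have X: "fls_X_inv * f = g \<longleftrightarrow> f = fls_X * g" for f g :: "real fls"
    by (auto simp: fls_X_inv_times_conv_shift fls_X_times_conv_shift)
  have "theta_identity x T \<longleftrightarrow>
      fls_X_inv * fps_to_fls (T - fps_const x) = fps_to_fls (U - fps_const (arctan x) - S)"
    unfolding theta_identity_def U_def[symmetric] S_def[symmetric]
    by (simp add: algebra_simps)
  also have "\<dots> \<longleftrightarrow> fps_to_fls (T - fps_const x) = fps_to_fls (fps_X * (U - fps_const (arctan x) - S))"
    unfolding X by (simp only: fls_times_fps_to_fls fps_X_to_fls)
  also have "\<dots> \<longleftrightarrow> T = theta_step x T"
    unfolding fps_to_fls_eq_iff theta_step_def U_def S_def by (auto simp: algebra_simps)
  finally show ?thesis .
qed

lemma fps_power_nth_cong: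
  fixes A B :: "'a::comm_ring_1 fps"
  assumes "\<And>i. i \<le> n \<Longrightarrow> A $ i = B $ i" "m \<le> n"
  shows "(A ^ k) $ m = (B ^ k) $ m"
  using \<open>m \<le> n\<close>
proof (induction k arbitrary: m)
  case (Suc k)
  then show ?case using assms(1) by (auto simp: fps_mult_nth intro!: sum.cong)
qed simp

lemma fps_subst_nth_cong:
  assumes "\<And>i. i \<le> n \<Longrightarrow> T $ i = T' $ i"
  shows "fps_subst f T $ n = fps_subst f T' $ n"
proof -
  have "((T - fps_const (T $ 0)) ^ k) $ n = ((T' - fps_const (T' $ 0)) ^ k) $ n" for k
    by (rule fps_power_nth_cong[where n = n]) (use assms in auto)
  then show ?thesis unfolding fps_subst_nth using assms[of 0] by simp
qed

lemma theta_step_nth_Suc: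
  "theta_step x T $ Suc n = fps_subst arctan T $ n - (if n = 0 then arctan x else 0)
     - (\<Sum>s<n. fps_subst (L_coeff (Suc s)) T $ (n - Suc s))"
  by (simp add: theta_step_def fps_nth_suminf_X_power del: power_Suc)

lemma theta_step_nth_0: "theta_step x T $ 0 = x"
  by (simp add: theta_step_def)

text \<open>
  The factor X in front makes the n-th coefficient of theta_step x T depend on the earlier
  coefficients of T only; so the identity determines T coefficient by coefficient.
\<close>
lemma theta_step_causal:
  assumes "\<And>i. i < n \<Longrightarrow> T $ i = T' $ i"
  shows "theta_step x T $ n = theta_step x T' $ n"
proof (cases n)
  case (Suc m)
  have "fps_subst f T $ k = fps_subst f T' $ k" if "k \<le> m" for f k
    by (rule fps_subst_nth_cong) (use that Suc assms in auto)
  then show ?thesis unfolding Suc theta_step_nth_Suc by simp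
qed (simp add: theta_step_nth_0)

lemma causal_fixpoint:
  fixes \<Psi> :: "'a::zero fps \<Rightarrow> 'a fps"
  assumes causal: "\<And>n T T'. (\<And>i. i < n \<Longrightarrow> T $ i = T' $ i) \<Longrightarrow> \<Psi> T $ n = \<Psi> T' $ n"
  shows "\<exists>!T. T = \<Psi> T"
proof
  (* Coefficient n of the iterates no longer changes after step n + 1. *)
  define it where "it k = (\<Psi> ^^ k) 0" for k
  have stable: "it (Suc m) $ n = it m $ n" if "n < m" for m n
    using that
  proof (induction m arbitrary: n)
    case (Suc m)
    show ?case unfolding it_def funpow.simps comp_def
      by (rule causal) (use Suc in \<open>auto simp: it_def\<close>)
  qed simp
  have stable': "it m $ n = it (Suc n) $ n" if "n < m" for m n
    using that by (induction m) (auto simp: stable less_Suc_eq)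
  define T where "T = Abs_fps (\<lambda>n. it (Suc n) $ n)"
  show "T = \<Psi> T"
  proof (rule fps_ext)
    fix n
    have "\<Psi> (it n) $ n = \<Psi> T $ n" by (rule causal) (simp add: T_def, rule stable')
    then show "T $ n = \<Psi> T $ n" by (simp add: T_def it_def)
  qed
  fix T' assume T': "T' = \<Psi> T'"
  have "T' $ n = T $ n" for n
  proof (induction n rule: less_induct)
    case (less n)
    then have "\<Psi> T' $ n = \<Psi> T $ n" by (intro causal)
    then show ?case using \<open>T = \<Psi> T\<close> T' by metis
  qed
  then show "T' = T" by (simp add: fps_eq_iff)
qed

text \<open>
  The THE in theta_series is justified by the unique fixed point; its coefficient of X vanishes
  because arctan x cancels.
\<close>
lemma theta_series_fixpoint: "theta_series x = theta_step x (theta_series x)"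
  and theta_series_0: "theta_series x $ 0 = x"
  and theta_series_1: "theta_series x $ 1 = 0"
proof -
  obtain T where T: "T = theta_step x T" and uniq: "\<And>T'. T' = theta_step x T' \<Longrightarrow> T' = T"
    using causal_fixpoint[of "theta_step x"] theta_step_causal by (metis (no_types, lifting))
  have T0: "T $ 0 = x" by (subst T) (rule theta_step_nth_0)
  have T1: "T $ 1 = 0"
  proof -
    have "T $ Suc 0 = theta_step x T $ Suc 0" using T by (rule arg_cong)
    also have "\<dots> = 0" unfolding theta_step_nth_Suc fps_subst_nth by (simp add: T0)
    finally show ?thesis by simp
  qed
  have eq: "theta_series x = T"
    unfolding theta_series_def theta_identity_iff_fixpoint
  proof (rule the_equality)
    show "T $ 0 = x \<and> T $ 1 = 0 \<and> T = theta_step x T" by (intro conjI T T0 T1)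
  qed (elim conjE, rule uniq)
  show "theta_series x = theta_step x (theta_series x)" "theta_series x $ 0 = x" "theta_series x $ 1 = 0"
    unfolding eq by fact+
qed

text \<open>
  By induction: the coefficient of X^(m+1) is a combination of coefficients of order at most m of
  substitutions into functions with bounded derivatives, and these are bounded by expands_fps_subst.
\<close>
lemma theta_series_tail_bounded:
  "\<exists>C. \<forall>x\<in>UNIV. norm ((theta_series x - fps_const x) $ n) \<le> C"
proof (induction n rule: less_induct)
  case (less n)
  show ?case
  proof (cases n)
    case 0
    then show ?thesis by (auto simp: theta_series_0)
  next
    case (Suc m)
    let ?h = "\<lambda>x. theta_series x - fps_const x"
    have h: "expands UNIV m ?h (\<lambda>x \<epsilon>. \<Sum>k\<le>m. ?h x $ k * of_real \<epsilon> ^ k)"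
      by (rule expands_polynomial) (use less Suc in auto)
    have bd: "\<exists>C. \<forall>x. \<bar>fps_subst f (theta_series x) $ k\<bar> \<le> C" if "bounded_derivs f" "k \<le> m" for f k
    proof -
      from expands_fps_subst[OF that(1) h]
      have "expands UNIV m (\<lambda>x. fps_subst f (theta_series x))
          (\<lambda>x \<epsilon>. f (x + (\<Sum>k\<le>m. ?h x $ k * of_real \<epsilon> ^ k)))"
        by (simp add: theta_series_0)
      then show ?thesis by (rule expandsE) (use that in auto)
    qed
    obtain A where A: "\<And>x. \<bar>fps_subst arctan (theta_series x) $ m\<bar> \<le> A"
      using bd[OF bounded_derivs_arctan] by blast
    have "\<exists>C. \<forall>x. \<bar>fps_subst (L_coeff (Suc s)) (theta_series x) $ (m - Suc s)\<bar> \<le> C" for s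
      by (rule bd) (auto intro: bounded_derivs_L_coeff)
    then obtain B where B: "\<And>s x. \<bar>fps_subst (L_coeff (Suc s)) (theta_series x) $ (m - Suc s)\<bar> \<le> B s"
      by metis
    have "norm (?h x $ n) \<le> A + pi / 2 + (\<Sum>s<m. B s)" for x
    proof -
      have *: "\<bar>u - v - w\<bar> \<le> A + pi / 2 + D" if "\<bar>u\<bar> \<le> A" "\<bar>v\<bar> \<le> pi / 2" "\<bar>w\<bar> \<le> D" for u v w D :: real
        using that by linarith
      have h: "?h x $ n = theta_step x (theta_series x) $ Suc m"
        unfolding theta_series_fixpoint[of x, symmetric] using Suc by simp
      have "\<bar>\<Sum>s<m. fps_subst (L_coeff (Suc s)) (theta_series x) $ (m - Suc s)\<bar> \<le> (\<Sum>s<m. B s)"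
        by (rule order_trans[OF sum_abs sum_mono]) (rule B)
      moreover have "\<bar>if m = 0 then arctan x else 0\<bar> \<le> pi / 2"
        using abs_arctan_le[of x] by auto
      ultimately show ?thesis unfolding h theta_step_nth_Suc real_norm_def using A[of x] by (intro *)
    qed
    then show ?thesis by blast
  qed
qed

text \<open>
  The truncated series solves the defining equation up to a uniform error: since the formal
  identity is exact, substituting the truncation leaves only terms of order N + 1 in the equation
  multiplied by 1/a.
\<close>
lemma theta_partial_sum_residual:
  obtains C where "C \<ge> 0"
    "\<And>a x. a \<ge> 1 \<Longrightarrow>
      \<bar>(a * (x + (\<Sum>k=2..N. q_coeff k x / a ^ k)) - arctan (x + (\<Sum>k=2..N. q_coeff k x / a ^ k))
        + (\<Sum>s=1..N. L_coeff s (x + (\<Sum>k=2..N. q_coeff k x / a ^ k)) / a ^ s)) - (a * x - arctan x)\<bar>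
        \<le> C / a ^ N"
proof -
  let ?h = "\<lambda>x. theta_series x - fps_const x"
  define \<phi> where "\<phi> = (\<lambda>x (\<epsilon>::real). \<Sum>k\<le>N. ?h x $ k * of_real \<epsilon> ^ k)"
  have h: "expands UNIV N ?h \<phi>"
    unfolding \<phi>_def by (rule expands_polynomial) (rule theta_series_tail_bounded)
  have sub: "expands UNIV N (\<lambda>x. fps_subst f (theta_series x)) (\<lambda>x \<epsilon>. f (x + \<phi> x \<epsilon>))"
    if "bounded_derivs f" for f
    using expands_fps_subst[OF that h] by (simp add: theta_series_0)
  have atn: "expands UNIV N (\<lambda>x. fps_const (arctan x)) (\<lambda>x \<epsilon>. arctan x)"
    by (rule expands_const[where C = "pi / 2"]) (use abs_arctan_le in auto)
  define R where "R = (\<lambda>x. ?h x - fps_X * (fps_subst arctan (theta_series x) - fps_const (arctan x)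
      - (\<Sum>s<N. fps_subst (L_coeff (Suc s)) (theta_series x) * fps_X ^ Suc s)))"
  define r where "r = (\<lambda>x \<epsilon>. \<phi> x \<epsilon> - of_real \<epsilon> * (arctan (x + \<phi> x \<epsilon>) - arctan x
      - (\<Sum>s<N. L_coeff (Suc s) (x + \<phi> x \<epsilon>) * of_real \<epsilon> ^ Suc s)))"
  have "expands UNIV N R r"
    unfolding R_def r_def
    by (intro expands_diff expands_mult expands_sum expands_power expands_X h sub atn
        bounded_derivs_arctan bounded_derivs_L_coeff) auto
  moreover have "R x $ k = 0" if "k \<le> N" for x k
  proof (cases k)
    case 0
    then show ?thesis by (simp add: R_def theta_series_0)
  next
    case (Suc m)
    have "(\<Sum>s<N. fps_subst (L_coeff (Suc s)) (theta_series x) * fps_X ^ Suc s) $ m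
      = (\<Sum>s<N. if m < Suc s then 0 else fps_subst (L_coeff (Suc s)) (theta_series x) $ (m - Suc s))"
      by (simp only: fps_sum_nth fps_X_power_mult_right_nth)
    also have "\<dots> = (\<Sum>s<m. if m < Suc s then 0 else fps_subst (L_coeff (Suc s)) (theta_series x) $ (m - Suc s))"
      by (rule sum.mono_neutral_right) (use that Suc in auto)
    finally have "(\<Sum>s<N. fps_subst (L_coeff (Suc s)) (theta_series x) * fps_X ^ Suc s) $ m
      = (\<Sum>s<m. fps_subst (L_coeff (Suc s)) (theta_series x) $ (m - Suc s))" by simp
    moreover have "theta_series x $ Suc m = theta_step x (theta_series x) $ Suc m"
      using theta_series_fixpoint[of x] by (rule arg_cong)
    ultimately show ?thesis unfolding theta_step_nth_Suc R_def Suc by (simp del: power_Suc)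
  qed
  ultimately obtain C where C: "C \<ge> 0"
    "\<And>x \<epsilon>. 0 < \<epsilon> \<Longrightarrow> \<epsilon> \<le> 1 \<Longrightarrow> norm (r x \<epsilon>) \<le> C * \<epsilon> ^ Suc N"
    by (elim expands_coeff_zero) auto
  show thesis
  proof (rule that[OF C(1)])
    fix a x :: real assume a: "a \<ge> 1"
    define \<theta> where "\<theta> = x + (\<Sum>k=2..N. q_coeff k x / a ^ k)"
    have "\<phi> x (1 / a) = (\<Sum>k=2..N. ?h x $ k * (1 / a) ^ k)"
      unfolding \<phi>_def of_real_eq_id id_apply
    proof (rule sum.mono_neutral_right)
      show "\<forall>k\<in>{..N} - {2..N}. ?h x $ k * (1 / a) ^ k = 0"
      proof
        fix k assume "k \<in> {..N} - {2..N}"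
        then have "k = 0 \<or> k = 1" by auto
        then show "?h x $ k * (1 / a) ^ k = 0"
          using theta_series_0[of x] theta_series_1[of x] by auto
      qed
    qed auto
    also have "\<dots> = (\<Sum>k=2..N. q_coeff k x / a ^ k)"
      by (intro sum.cong) (auto simp: q_coeff_def power_one_over divide_simps)
    finally have \<phi>: "x + \<phi> x (1 / a) = \<theta>" by (simp add: \<theta>_def)
    have "(\<Sum>s<N. L_coeff (Suc s) (\<theta>) * (1 / a) ^ Suc s) = (\<Sum>s=1..N. L_coeff s (\<theta>) / a ^ s)"
      by (rule sum.reindex_bij_witness[of _ "\<lambda>s. s - 1" Suc]) (auto simp: power_one_over divide_simps)
    then have r: "r x (1 / a) = (\<theta> - x) - 1 / a * (arctan (\<theta>) - arctan x - (\<Sum>s=1..N. L_coeff s (\<theta>) / a ^ s))"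
      unfolding r_def \<phi> using \<phi> by (simp del: power_Suc)
    have "(a * \<theta> - arctan (\<theta>) + (\<Sum>s=1..N. L_coeff s (\<theta>) / a ^ s)) - (a * x - arctan x) = a * r x (1 / a)"
      unfolding r using a by (simp add: field_simps)
    also have "\<bar>\<dots>\<bar> \<le> a * (C * (1 / a) ^ Suc N)"
      using C(2)[of "1 / a" x] a unfolding abs_mult by (intro mult_mono) auto
    also have "\<dots> = C / a ^ N" using a by (simp add: power_one_over)
    finally show "\<bar>(a * (x + (\<Sum>k=2..N. q_coeff k x / a ^ k)) - arctan (x + (\<Sum>k=2..N. q_coeff k x / a ^ k))
        + (\<Sum>s=1..N. L_coeff s (x + (\<Sum>k=2..N. q_coeff k x / a ^ k)) / a ^ s)) - (a * x - arctan x)\<bar>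
        \<le> C / a ^ N" unfolding \<theta>_def .
  qed
qed

section \<open>The complex integral and its amplitude\<close>

text \<open>
  The integral of t^(a-1) e^(it) over [0, z].
\<close>
definition CS_int :: "real \<Rightarrow> real \<Rightarrow> complex" where
  "CS_int a z = Complex (Ci_fun a z) (Si_fun a z)"

lemma powr_trig_continuous:
  fixes a :: real
  assumes "a > 1"
  shows "continuous_on {0..b} (\<lambda>t. t powr (a - 1) * cos t)" "continuous_on {0..b} (\<lambda>t. t powr (a - 1) * sin t)"
  using assms by (auto intro!: continuous_intros continuous_on_powr')

lemma Ci_Si_within:
  assumes "a > 1" "z \<in> {0..b}"
  shows "(Ci_fun a has_real_derivative z powr (a - 1) * cos z) (at z within {0..b})"
    "(Si_fun a has_real_derivative z powr (a - 1) * sin z) (at z within {0..b})"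
  unfolding Ci_fun_def[abs_def] Si_fun_def[abs_def]
  using integral_has_real_derivative[OF powr_trig_continuous(1)[OF assms(1)] assms(2)]
    integral_has_real_derivative[OF powr_trig_continuous(2)[OF assms(1)] assms(2)] by auto

lemma CS_int_has_vector_derivative:
  assumes "a > 1" "z > 0"
  shows "(CS_int a has_vector_derivative of_real (z powr (a - 1)) * cis z) (at z)"
proof -
  have "at z within {0..z+1} = at z" using assms by (intro at_within_interior) auto
  then have d: "(Ci_fun a has_real_derivative z powr (a - 1) * cos z) (at z)"
    "(Si_fun a has_real_derivative z powr (a - 1) * sin z) (at z)"
    using Ci_Si_within[OF assms(1), of z "z + 1"] assms by auto
  have "((\<lambda>z. of_real (Ci_fun a z) + \<i> * of_real (Si_fun a z)) has_vector_derivative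
      of_real (z powr (a - 1) * cos z) + \<i> * of_real (z powr (a - 1) * sin z)) (at z)"
    using d by (auto intro!: derivative_eq_intros has_vector_derivative_of_real simp: has_real_derivative_iff_has_vector_derivative)
  moreover have "of_real (z powr (a - 1) * cos z) + \<i> * of_real (z powr (a - 1) * sin z) = of_real (z powr (a - 1)) * cis z"
    by (simp add: complex_eq_iff)
  ultimately show ?thesis
    by (simp add: CS_int_def[abs_def] Complex_eq)
qed

lemma CS_int_continuous:
  assumes "a > 1"
  shows "continuous_on {0..b} (CS_int a)"
  unfolding CS_int_def[abs_def] Complex_eq
  by (intro continuous_intros DERIV_continuous_on[where D = "\<lambda>z. z powr (a - 1) * cos z"]
      DERIV_continuous_on[where D = "\<lambda>z. z powr (a - 1) * sin z"] Ci_Si_within assms)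

text \<open>
  The product w K: the integral with its growth and its oscillation divided out, so that only a
  slowly varying factor remains.
\<close>
definition Ti_amplitude :: "real \<Rightarrow> real \<Rightarrow> complex" where
  "Ti_amplitude a \<theta> = of_real (a * (a * \<theta>) powr (- a)) * cis (- (a * \<theta>)) * CS_int a (a * \<theta>)"

lemma CS_int_eq_amplitude:
  assumes "a > 0" "\<theta> > 0"
  shows "CS_int a (a * \<theta>) = of_real ((a * \<theta>) powr a / a) * cis (a * \<theta>) * Ti_amplitude a \<theta>"
proof -
  have "(a * \<theta>) powr a / a * (a * (a * \<theta>) powr (- a)) = 1"
    using assms by (simp add: powr_minus divide_simps)
  then have *: "of_real ((a * \<theta>) powr a / a) * of_real (a * (a * \<theta>) powr (- a)) = (1::complex)"
    by (simp only: of_real_mult[symmetric] of_real_1)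
  have "of_real ((a * \<theta>) powr a / a) * cis (a * \<theta>) * Ti_amplitude a \<theta> =
     (of_real ((a * \<theta>) powr a / a) * of_real (a * (a * \<theta>) powr (- a))) * (cis (a * \<theta>) * cis (- (a * \<theta>))) * CS_int a (a * \<theta>)"
    unfolding Ti_amplitude_def by (simp only: ac_simps)
  then show ?thesis unfolding * by (simp add: cis_mult)
qed

lemma CS_int_scaled_derivative:
  assumes "a > 1" "\<theta> > 0"
  shows "((\<lambda>\<theta>. CS_int a (a * \<theta>)) has_vector_derivative
     of_real (a * (a * \<theta>) powr (a - 1)) * cis (a * \<theta>)) (at \<theta>)"
proof -
  have "((CS_int a \<circ> (\<lambda>\<theta>. a * \<theta>)) has_vector_derivative
      a *\<^sub>R (of_real ((a * \<theta>) powr (a - 1)) * cis (a * \<theta>))) (at \<theta>)"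
  proof (rule vector_diff_chain_at)
    show "((\<lambda>\<theta>. a * \<theta>) has_vector_derivative a) (at \<theta>)"
      by (auto intro!: derivative_eq_intros)
    show "(CS_int a has_vector_derivative of_real ((a * \<theta>) powr (a - 1)) * cis (a * \<theta>)) (at (a * \<theta>))"
      by (rule CS_int_has_vector_derivative) (use assms in auto)
  qed
  then show ?thesis by (simp add: o_def scaleR_conv_of_real algebra_simps)
qed

lemma cis_scaled_derivative:
  "((\<lambda>t. cis (c * t)) has_vector_derivative of_real c * \<i> * cis (c * t)) (at t within S)"
proof -
  have "((\<lambda>z. exp (\<i> * (of_real c * z))) has_field_derivative of_real c * \<i> * cis (c * t)) (at (of_real t))"
    by (auto intro!: derivative_eq_intros simp: cis_conv_exp)
  from has_vector_derivative_real_field[OF this] show ?thesis by (simp add: cis_conv_exp)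
qed

lemma powr_scaled_derivative:
  fixes a t :: real
  assumes "a > 0" "t > 0"
  shows "((\<lambda>t. of_real ((a * t) powr b) :: complex) has_vector_derivative of_real (a * b * (a * t) powr (b - 1))) (at t)"
proof (rule has_vector_derivative_of_real)
  show "((\<lambda>t. (a * t) powr b) has_real_derivative a * b * (a * t) powr (b - 1)) (at t)"
    using assms by (auto intro!: derivative_eq_intros simp: powr_diff field_simps)
qed

text \<open>
  The product (a\<theta>)^a e^(\<i>a\<theta>) Ti_amplitude / a is an integral with a known integrand. Differentiating
  it gives a linear first order equation, whose formal solution in powers of 1/a starts with w.
\<close>
lemma Ti_amplitude_ode:
  assumes "a > 1" "\<theta> > 0"
  shows "(Ti_amplitude a has_vector_derivative
      of_real (a / \<theta>) * (1 - Ti_amplitude a \<theta> / cw \<theta>)) (at \<theta>)"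
proof -
  define z where "z = a * \<theta>"
  have z: "z > 0" using assms by (simp add: z_def)
  have "(Ti_amplitude a has_vector_derivative
     (of_real a * (of_real (a * (- a) * z powr (- a - 1))) * cis (- a * \<theta>) +
      of_real a * of_real (z powr (- a)) * (of_real (- a) * \<i> * cis (- a * \<theta>))) * CS_int a z +
     of_real a * of_real (z powr (- a)) * cis (- a * \<theta>) * (of_real (a * z powr (a - 1)) * cis z)) (at \<theta>)"
  proof -
    have eq: "Ti_amplitude a = (\<lambda>\<theta>. (of_real a * of_real ((a * \<theta>) powr (- a)) * cis (- a * \<theta>)) * CS_int a (a * \<theta>))"
      by (simp add: Ti_amplitude_def[abs_def])
    have 1: "((\<lambda>\<theta>. of_real a * of_real ((a * \<theta>) powr (- a)) :: complex) has_vector_derivative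
        of_real a * (of_real (a * (- a) * z powr (- a - 1)))) (at \<theta>)"
      unfolding z_def by (rule has_vector_derivative_mult_right, rule powr_scaled_derivative) (use assms in auto)
    have 2: "((\<lambda>\<theta>. CS_int a (a * \<theta>)) has_vector_derivative
        of_real (a * z powr (a - 1)) * cis z) (at \<theta>)"
      unfolding z_def by (rule CS_int_scaled_derivative) (use assms in auto)
    show ?thesis
      unfolding eq
      by (rule has_vector_derivative_eq_rhs,
          rule has_vector_derivative_mult[OF has_vector_derivative_mult[OF 1 cis_scaled_derivative] 2])
        (simp add: z_def algebra_simps)
  qed
  moreover have "(of_real a * (of_real (a * (- a) * z powr (- a - 1))) * cis (- a * \<theta>) +
      of_real a * of_real (z powr (- a)) * (of_real (- a) * \<i> * cis (- a * \<theta>))) * CS_int a z +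
     of_real a * of_real (z powr (- a)) * cis (- a * \<theta>) * (of_real (a * z powr (a - 1)) * cis z)
     = of_real (a / \<theta>) * (1 - Ti_amplitude a \<theta> / cw \<theta>)"
  proof -
    have c: "cis (- a * \<theta>) * cis z = 1" by (simp add: cis_mult z_def)
    have p: "z powr (- a) * (a * z powr (a - 1)) = 1 / \<theta>"
      using z assms by (simp add: powr_diff powr_minus z_def divide_simps)
    have p': "a * (- a) * z powr (- a - 1) = - (a / \<theta>) * z powr (- a)"
      using z assms by (simp add: powr_diff z_def divide_simps)
    have "of_real a * of_real (z powr (- a)) * cis (- a * \<theta>) * (of_real (a * z powr (a - 1)) * cis z) =
      of_real (a * (z powr (- a) * (a * z powr (a - 1)))) * (cis (- a * \<theta>) * cis z)"
      by (simp only: of_real_mult ac_simps)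
    also have "\<dots> = of_real (a / \<theta>)" unfolding p c by simp
    finally have 2: "of_real a * of_real (z powr (- a)) * cis (- a * \<theta>) * (of_real (a * z powr (a - 1)) * cis z) = of_real (a / \<theta>)" .
    have T: "of_real a * of_real (z powr (- a)) * cis (- a * \<theta>) * CS_int a z = Ti_amplitude a \<theta>"
      by (simp add: Ti_amplitude_def z_def)
    have "(of_real a * (of_real (a * (- a) * z powr (- a - 1))) * cis (- a * \<theta>) +
      of_real a * of_real (z powr (- a)) * (of_real (- a) * \<i> * cis (- a * \<theta>))) * CS_int a z
      = - (of_real (a / \<theta>) + of_real a * \<i>) * (of_real a * of_real (z powr (- a)) * cis (- a * \<theta>) * CS_int a z)"
      unfolding p' by (simp add: algebra_simps)
    also have "\<dots> = - (of_real (a / \<theta>) + of_real a * \<i>) * Ti_amplitude a \<theta>" unfolding T ..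
    also have "of_real (a / \<theta>) + of_real a * \<i> = of_real (a / \<theta>) * (1 / cw \<theta>)"
      using assms unfolding inverse_cw by (simp add: field_simps)
    finally show ?thesis unfolding 2 by (simp add: algebra_simps)
  qed
  ultimately show ?thesis by simp
qed

lemma norm_cw_mult: "t \<ge> 0 \<Longrightarrow> norm (cw t) * norm (cw t - 1) = t / (1 + t\<^sup>2)"
  unfolding cw_minus_1 by (simp add: norm_mult norm_cw divide_simps add_nonneg_eq_0_iff)

text \<open>
  An approximate solution S of the differential equation is close to the true one. Multiplied by the
  integrating factor (at)^a e^(\<i>at), the difference vanishes at 0 and has a derivative of
  modulus at most c (at)^(a-1) t/(1 + t^2). As t^2/(1 + t^2) is increasing, integration up to \<theta>
  reproduces the weight \<theta>/(1 + \<theta>^2) = |w| |w - 1| and gains a factor 1/(a - 1). The weight controls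
  the relative error |w - 1| both for small and for large \<theta>.
\<close>
lemma Ti_amplitude_comparison:
  assumes a: "a > 1" and \<theta>: "\<theta> > 0"
    and S: "\<And>t. t \<ge> 0 \<Longrightarrow> (S has_vector_derivative S' t) (at t)"
    and residual: "\<And>t. t > 0 \<Longrightarrow>
       norm (of_real t * S' t + of_real a / cw t * S t - of_real a) \<le> c * (norm (cw t) * norm (cw t - 1))"
  shows "norm (Ti_amplitude a \<theta> - S \<theta>) \<le> c / (a - 1) * (norm (cw \<theta>) * norm (cw \<theta> - 1))"
proof -
  define B where "B = (\<lambda>t. of_real ((a * t) powr a) * cis (a * t) * S t / of_real a - CS_int a (a * t))"
  define B' where "B' = (\<lambda>t. of_real ((a * t) powr (a - 1)) * cis (a * t) *
     (of_real t * S' t + of_real a / cw t * S t - of_real a))"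
  have c0: "c \<ge> 0"
    using order_trans[OF norm_ge_zero residual[of 1]] by (simp add: zero_le_mult_iff norm_cw_mult)
  (* The constant k takes the increasing factor of the bound at the right end point. *)
  define k where "k = c * (\<theta>\<^sup>2 / (1 + \<theta>\<^sup>2)) * a powr (a - 1)"
  have contS: "continuous_on {0..\<theta>} S"
    using S by (intro continuous_at_imp_continuous_on ballI) (auto dest: has_vector_derivative_continuous)
  have "norm (B \<theta> - B 0) \<le> k / (a - 1) * \<theta> powr (a - 1) - k / (a - 1) * 0 powr (a - 1)"
  proof (rule differentiable_bound_general[where f' = B' and \<phi>' = "\<lambda>t. k * t powr (a - 2)"])
    have "continuous_on {0..\<theta>} (\<lambda>x. (a * x) powr a)"
      using a by (intro continuous_on_powr' continuous_intros) auto
    moreover have "continuous_on {0..\<theta>} (\<lambda>x. CS_int a (a * x))"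
      by (rule continuous_on_compose2[OF CS_int_continuous[OF a, of "a * \<theta>"]])
        (use a in \<open>auto intro!: continuous_intros\<close>)
    moreover have "continuous_on {0..\<theta>} (\<lambda>x. cis (a * x))"
      unfolding cis_conv_exp by (intro continuous_intros)
    ultimately show "continuous_on {0..\<theta>} B"
      unfolding B_def using a
      by (intro continuous_on_diff continuous_on_divide continuous_on_mult continuous_on_of_real contS continuous_on_const) auto
    show "continuous_on {0..\<theta>} (\<lambda>t. k / (a - 1) * t powr (a - 1))"
      using a by (intro continuous_intros continuous_on_powr') auto
    fix t assume t: "0 < t" "t < \<theta>"
    have p: "(a * t) powr a = a * t * (a * t) powr (a - 1)" using a t by (simp add: powr_diff)
    have "(B has_vector_derivative
       ((of_real (a * a * (a * t) powr (a - 1)) * cis (a * t) +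
         of_real ((a * t) powr a) * (of_real a * \<i> * cis (a * t))) * S t +
        of_real ((a * t) powr a) * cis (a * t) * S' t) / of_real a
       - of_real (a * (a * t) powr (a - 1)) * cis (a * t)) (at t)"
      unfolding B_def
      by (rule has_vector_derivative_eq_rhs,
          rule has_vector_derivative_diff[OF has_vector_derivative_divide[OF
            has_vector_derivative_mult[OF has_vector_derivative_mult[OF
              powr_scaled_derivative cis_scaled_derivative] S]] CS_int_scaled_derivative])
        (use a t in \<open>auto simp: algebra_simps\<close>)
    also have "((of_real (a * a * (a * t) powr (a - 1)) * cis (a * t) +
         of_real ((a * t) powr a) * (of_real a * \<i> * cis (a * t))) * S t +
        of_real ((a * t) powr a) * cis (a * t) * S' t) / of_real a
       - of_real (a * (a * t) powr (a - 1)) * cis (a * t) = B' t"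
    proof -
      have "a \<noteq> 0" using a by simp
      have "of_real a / cw t = of_real a * (1 + \<i> * of_real t)"
        unfolding inverse_cw[symmetric] by simp
      then show ?thesis unfolding B'_def p using \<open>a \<noteq> 0\<close> by (simp add: field_simps)
    qed
    finally show "(B has_vector_derivative B' t) (at t)" .
    have "((\<lambda>t. k / (a - 1) * t powr (a - 1)) has_real_derivative k / (a - 1) * ((a - 1) * t powr (a - 1 - 1))) (at t)"
      using t by (intro DERIV_cmult has_real_derivative_powr) auto
    then show "((\<lambda>t. k / (a - 1) * t powr (a - 1)) has_vector_derivative k * t powr (a - 2)) (at t)"
      using a by (simp add: has_real_derivative_iff_has_vector_derivative)
    have "norm (B' t) = (a * t) powr (a - 1) * norm (of_real t * S' t + of_real a / cw t * S t - of_real a)"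
      unfolding B'_def norm_mult by simp
    also have "\<dots> \<le> (a * t) powr (a - 1) * (c * (t / (1 + t\<^sup>2)))"
      using residual[OF t(1)] t by (intro mult_left_mono) (simp_all only: norm_cw_mult less_imp_le powr_ge_zero)
    also have "\<dots> = c * (t\<^sup>2 / (1 + t\<^sup>2)) * a powr (a - 1) * t powr (a - 2)"
    proof -
      have "t powr (a - 1) = t * t powr (a - 2)" using t by (simp add: powr_mult_base)
      then show ?thesis using a t by (simp add: powr_mult power2_eq_square)
    qed
    also have "\<dots> \<le> k * t powr (a - 2)"
    proof -
      have "t\<^sup>2 / (1 + t\<^sup>2) \<le> \<theta>\<^sup>2 / (1 + \<theta>\<^sup>2)"
      proof -
        have "t\<^sup>2 \<le> \<theta>\<^sup>2" using t by (intro power_mono) auto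
        then show ?thesis by (simp add: divide_simps add_pos_nonneg algebra_simps)
      qed
      then show ?thesis unfolding k_def using c0 by (intro mult_right_mono mult_left_mono) auto
    qed
    finally show "norm (B' t) \<le> k * t powr (a - 2)" .
  qed (use \<theta> in auto)
  moreover have "B 0 = 0"
    by (simp add: B_def CS_int_def Ci_fun_def Si_fun_def complex_eq_iff)
  ultimately have B: "norm (B \<theta>) \<le> k / (a - 1) * \<theta> powr (a - 1)" by simp
  have "Ti_amplitude a \<theta> - S \<theta> = - (of_real (a * (a * \<theta>) powr (- a)) * cis (- (a * \<theta>))) * B \<theta>"
  proof -
    have "of_real (a * (a * \<theta>) powr (- a)) * cis (- (a * \<theta>)) * (of_real ((a * \<theta>) powr a) * cis (a * \<theta>) * S \<theta> / of_real a)
      = of_real (a * (a * \<theta>) powr (- a) * (a * \<theta>) powr a / a) * (cis (- (a * \<theta>)) * cis (a * \<theta>)) * S \<theta>"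
      by (simp only: of_real_mult of_real_divide times_divide_eq_right times_divide_eq_left ac_simps)
    also have "\<dots> = S \<theta>"
      using a \<theta> by (simp add: cis_mult powr_minus)
    finally show ?thesis unfolding B_def Ti_amplitude_def by (simp add: algebra_simps)
  qed
  then have "norm (Ti_amplitude a \<theta> - S \<theta>) = a * (a * \<theta>) powr (- a) * norm (B \<theta>)"
    using a by (simp add: norm_mult)
  also have "\<dots> \<le> a * (a * \<theta>) powr (- a) * (k / (a - 1) * \<theta> powr (a - 1))"
    using B a by (intro mult_left_mono) auto
  also have "\<dots> = c / (a - 1) * (\<theta> / (1 + \<theta>\<^sup>2))"
    using a \<theta> unfolding k_def
    by (simp add: powr_mult powr_minus powr_diff power2_eq_square) (simp add: divide_simps)
  finally show ?thesis using \<theta> by (simp add: norm_cw_mult)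
qed

lemma cw_has_vector_derivative: "(cw has_vector_derivative - \<i> * (cw t)\<^sup>2) (at t within X)"
  using poly_cw_has_vector_derivative[of "[:0, 1:]" t X]
  by (simp add: cw_deriv_def power2_eq_square pderiv_pCons ac_simps)

lemma Ti_amplitude_near_cw:
  assumes "a > 1" "\<theta> > 0"
  shows "norm (Ti_amplitude a \<theta> - cw \<theta>) \<le> 1 / (a - 1) * (norm (cw \<theta>) * norm (cw \<theta> - 1))"
proof (rule Ti_amplitude_comparison[OF assms cw_has_vector_derivative])
  fix t :: real assume "t > 0"
  have "of_real t * (- \<i> * (cw t)\<^sup>2) + of_real a / cw t * cw t - of_real a = cw t * (cw t - 1)"
    unfolding cw_minus_1 using cw_nonzero[of t] by (simp add: power2_eq_square)
  then show "norm (of_real t * (- \<i> * (cw t)\<^sup>2) + of_real a / cw t * cw t - of_real a)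
      \<le> 1 * (norm (cw t) * norm (cw t - 1))"
    by (simp add: norm_mult)
qed

text \<open>
  The imaginary part of w is -|w| |w - 1|, exactly the size of the weight in the comparison;
  hence an error with a factor 1/(a - 1) < 1 cannot change its sign, however small \<theta> is.
\<close>
lemma Im_Ti_amplitude_neg:
  assumes "a > 2" "\<theta> > 0"
  shows "Im (Ti_amplitude a \<theta>) < 0"
proof -
  let ?s = "norm (cw \<theta>) * norm (cw \<theta> - 1)"
  have s: "?s = \<theta> / (1 + \<theta>\<^sup>2)" using assms by (simp add: norm_cw_mult)
  have s0: "?s > 0" unfolding s using assms by (auto intro!: divide_pos_pos add_pos_nonneg)
  have "Im (Ti_amplitude a \<theta> - cw \<theta>) \<le> 1 / (a - 1) * ?s"
    using Ti_amplitude_near_cw[of a \<theta>] assms abs_Im_le_cmod[of "Ti_amplitude a \<theta> - cw \<theta>"] by linarith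
  also have "\<dots> < 1 * ?s" by (intro mult_strict_right_mono s0) (use assms in simp)
  finally show ?thesis unfolding s by (simp add: Im_cw)
qed

section \<open>The phase and the enumeration of the zeros\<close>

text \<open>
  The argument of the integral, as a continuous function of \<theta>: the imaginary part of Ti_amplitude
  is negative, so the principal logarithm never crosses its cut.
\<close>
definition Ti_phase :: "real \<Rightarrow> real \<Rightarrow> real" where
  "Ti_phase a \<theta> = a * \<theta> + Im (Ln (Ti_amplitude a \<theta>))"

lemma Ti_eq_cos_phase:
  assumes "a > 2" "\<theta> > 0"
  shows "Ti_fun a (a * \<theta>) \<alpha> =
    (a * \<theta>) powr a / a * norm (Ti_amplitude a \<theta>) * cos (Ti_phase a \<theta> - pi * \<alpha>)"
proof -
  have nz: "Ti_amplitude a \<theta> \<noteq> 0" using Im_Ti_amplitude_neg[OF assms] by auto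
  have "Ti_amplitude a \<theta> = of_real (norm (Ti_amplitude a \<theta>)) * cis (Im (Ln (Ti_amplitude a \<theta>)))"
    using nz by (metis exp_Ln exp_eq_polar norm_exp_eq_Re)
  then have "CS_int a (a * \<theta>) = of_real ((a * \<theta>) powr a / a) * cis (a * \<theta>) *
      (of_real (norm (Ti_amplitude a \<theta>)) * cis (Im (Ln (Ti_amplitude a \<theta>))))"
    using CS_int_eq_amplitude[of a \<theta>] assms by simp
  also have "\<dots> = of_real ((a * \<theta>) powr a / a * norm (Ti_amplitude a \<theta>)) *
      (cis (a * \<theta>) * cis (Im (Ln (Ti_amplitude a \<theta>))))"
    by (simp only: of_real_mult ac_simps)
  also have "\<dots> = of_real ((a * \<theta>) powr a / a * norm (Ti_amplitude a \<theta>)) * cis (Ti_phase a \<theta>)"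
    by (simp add: cis_mult Ti_phase_def)
  finally have J: "CS_int a (a * \<theta>) = of_real ((a * \<theta>) powr a / a * norm (Ti_amplitude a \<theta>)) * cis (Ti_phase a \<theta>)" .
  define r where "r = (a * \<theta>) powr a / a * norm (Ti_amplitude a \<theta>)"
  have "Ci_fun a (a * \<theta>) = r * cos (Ti_phase a \<theta>)" "Si_fun a (a * \<theta>) = r * sin (Ti_phase a \<theta>)"
    using arg_cong[OF J, of Re] arg_cong[OF J, of Im] unfolding r_def[symmetric] by (simp_all add: CS_int_def)
  then show ?thesis unfolding Ti_fun_def r_def[symmetric] by (simp add: cos_diff algebra_simps)
qed

lemma Ti_zero_iff_phase:
  assumes "a > 2" "\<theta> > 0"
  shows "Ti_fun a (a * \<theta>) \<alpha> = 0 \<longleftrightarrow> (\<exists>k::int. Ti_phase a \<theta> = (of_int k + \<alpha> - 1 / 2) * pi)"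
proof -
  have "Ti_amplitude a \<theta> \<noteq> 0" using Im_Ti_amplitude_neg[OF assms] by auto
  then have "Ti_fun a (a * \<theta>) \<alpha> = 0 \<longleftrightarrow> cos (Ti_phase a \<theta> - pi * \<alpha>) = 0"
    unfolding Ti_eq_cos_phase[OF assms] using assms by simp
  also have "\<dots> \<longleftrightarrow> (\<exists>i::int. odd i \<and> Ti_phase a \<theta> - pi * \<alpha> = of_int i * (pi / 2))"
    by (rule cos_zero_iff_int)
  also have "\<dots> \<longleftrightarrow> (\<exists>k::int. Ti_phase a \<theta> = (of_int k + \<alpha> - 1 / 2) * pi)"
  proof
    assume "\<exists>i::int. odd i \<and> Ti_phase a \<theta> - pi * \<alpha> = of_int i * (pi / 2)"
    then obtain j :: int where "Ti_phase a \<theta> - pi * \<alpha> = of_int (2 * j + 1) * (pi / 2)" by (auto elim: oddE)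
    then show "\<exists>k::int. Ti_phase a \<theta> = (of_int k + \<alpha> - 1 / 2) * pi"
      (* odd multiples 2j + 1 of \<pi>/2 are written as (k - 1/2)\<pi> with k = j + 1 *)
      by (intro exI[of _ "j + 1"]) (simp add: field_simps)
  next
    assume "\<exists>k::int. Ti_phase a \<theta> = (of_int k + \<alpha> - 1 / 2) * pi"
    then obtain k :: int where "Ti_phase a \<theta> = (of_int k + \<alpha> - 1 / 2) * pi" ..
    then show "\<exists>i::int. odd i \<and> Ti_phase a \<theta> - pi * \<alpha> = of_int i * (pi / 2)"
      by (intro exI[of _ "2 * k - 1"]) (simp add: field_simps)
  qed
  finally show ?thesis .
qed

text \<open>
  By the differential equation the derivative of the logarithm of Ti_amplitude is
  (a/\<theta>)(1/Ti_amplitude - 1 - \<i>\<theta>), and the imaginary part of the last term cancels the derivative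
  of a\<theta>.
\<close>
lemma Ti_phase_deriv:
  assumes "a > 2" "\<theta> > 0"
  shows "(Ti_phase a has_real_derivative a / \<theta> * Im (1 / Ti_amplitude a \<theta>)) (at \<theta>)"
proof -
  let ?R = "Ti_amplitude a"
  have im: "Im (?R \<theta>) < 0" by (rule Im_Ti_amplitude_neg[OF assms])
  then have nz: "?R \<theta> \<noteq> 0" by auto
  have nonpos: "?R \<theta> \<notin> \<real>\<^sub>\<le>\<^sub>0" using im by (auto simp: complex_nonpos_Reals_iff)
  have "((Ln \<circ> ?R) has_vector_derivative
      (of_real (a / \<theta>) * (1 - ?R \<theta> / cw \<theta>)) * (1 / ?R \<theta>)) (at \<theta>)"
  proof (rule field_vector_diff_chain_at)
    show "(?R has_vector_derivative of_real (a / \<theta>) * (1 - ?R \<theta> / cw \<theta>)) (at \<theta>)"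
      by (rule Ti_amplitude_ode) (use assms in auto)
    show "(Ln has_field_derivative 1 / ?R \<theta>) (at (?R \<theta>))"
      using has_field_derivative_Ln[OF nonpos] by (simp add: inverse_eq_divide)
  qed
  also have "(of_real (a / \<theta>) * (1 - ?R \<theta> / cw \<theta>)) * (1 / ?R \<theta>) = of_real (a / \<theta>) * (1 / ?R \<theta> - 1 / cw \<theta>)"
    using nz by (simp add: field_simps)
  finally have "((\<lambda>\<theta>. Im ((Ln \<circ> ?R) \<theta>)) has_vector_derivative
      Im (of_real (a / \<theta>) * (1 / ?R \<theta> - 1 / cw \<theta>))) (at \<theta>)"
    by (rule bounded_linear.has_vector_derivative[OF bounded_linear_Im])
  then have "((\<lambda>\<theta>. Im (Ln (?R \<theta>))) has_real_derivative a / \<theta> * (Im (1 / ?R \<theta>) - \<theta>)) (at \<theta>)"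
    unfolding has_real_derivative_iff_has_vector_derivative inverse_cw o_def by simp
  moreover have "((\<lambda>\<theta>. a * \<theta>) has_real_derivative a) (at \<theta>)"
    by (auto intro!: derivative_eq_intros)
  ultimately have "((\<lambda>\<theta>. a * \<theta> + Im (Ln (?R \<theta>))) has_real_derivative a + a / \<theta> * (Im (1 / ?R \<theta>) - \<theta>)) (at \<theta>)"
    by (intro DERIV_add)
  also have "a + a / \<theta> * (Im (1 / ?R \<theta>) - \<theta>) = a / \<theta> * Im (1 / ?R \<theta>)"
    using assms by (simp add: field_simps)
  finally show ?thesis unfolding Ti_phase_def[abs_def] .
qed

lemma Ti_phase_strict_mono:
  assumes "a > 2" "0 < \<theta>" "\<theta> < \<theta>'"
  shows "Ti_phase a \<theta> < Ti_phase a \<theta>'"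
proof (rule DERIV_pos_imp_increasing[OF assms(3)])
  fix t assume "\<theta> \<le> t" "t \<le> \<theta>'"
  then have t: "t > 0" using assms by simp
  have im: "Im (Ti_amplitude a t) < 0" by (rule Im_Ti_amplitude_neg[OF assms(1) t])
  then have "0 < (Re (Ti_amplitude a t))\<^sup>2 + (Im (Ti_amplitude a t))\<^sup>2"
    by (intro add_nonneg_pos) auto
  then have "Im (1 / Ti_amplitude a t) > 0"
    using im by (simp add: Im_divide divide_neg_pos)
  then show "\<exists>y. (Ti_phase a has_real_derivative y) (at t) \<and> 0 < y"
    using assms t by (intro exI[of _ "a / t * Im (1 / Ti_amplitude a t)"] conjI Ti_phase_deriv) auto
qed

lemma Im_Ln_cw: "Im (Ln (cw \<theta>)) = - arctan \<theta>"
proof -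
  have "exp (Complex (ln (norm (cw \<theta>))) (- arctan \<theta>)) = cw \<theta>"
  proof -
    have "exp (Complex (ln (norm (cw \<theta>))) (- arctan \<theta>)) = of_real (norm (cw \<theta>)) * cis (- arctan \<theta>)"
      using cw_nonzero[of \<theta>] by (simp add: exp_eq_polar)
    also have "\<dots> = cw \<theta>"
      by (simp add: complex_eq_iff norm_cw cos_arctan sin_arctan Re_cw Im_cw add_pos_nonneg)
    finally show ?thesis .
  qed
  moreover have "Ln (exp (Complex (ln (norm (cw \<theta>))) (- arctan \<theta>))) = Complex (ln (norm (cw \<theta>))) (- arctan \<theta>)"
    using arctan_lbound[of \<theta>] arctan_ubound[of \<theta>] pi_gt_zero
    by (intro Ln_exp) auto
  ultimately show ?thesis by simp
qed

text \<open>
  The factor K, the quotient of the amplitude and its leading term w.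
\<close>
definition Ti_ratio :: "real \<Rightarrow> real \<Rightarrow> complex" where
  "Ti_ratio a \<theta> = Ti_amplitude a \<theta> / cw \<theta>"

lemma Ti_ratio_near_1:
  assumes "a > 1" "\<theta> > 0"
  shows "norm (Ti_ratio a \<theta> - 1) \<le> norm (cw \<theta> - 1) / (a - 1)"
proof -
  have "Ti_ratio a \<theta> - 1 = (Ti_amplitude a \<theta> - cw \<theta>) / cw \<theta>"
    using cw_nonzero[of \<theta>] by (simp add: Ti_ratio_def field_simps)
  then have "norm (Ti_ratio a \<theta> - 1) = norm (Ti_amplitude a \<theta> - cw \<theta>) / norm (cw \<theta>)"
    by (simp add: norm_divide)
  also have "\<dots> \<le> (1 / (a - 1) * (norm (cw \<theta>) * norm (cw \<theta> - 1))) / norm (cw \<theta>)"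
    by (intro divide_right_mono Ti_amplitude_near_cw assms) auto
  also have "\<dots> = norm (cw \<theta> - 1) / (a - 1)" using cw_nonzero[of \<theta>] by simp
  finally show ?thesis .
qed

lemma norm_cw_minus_1:
  assumes "\<theta> > 0"
  shows "norm (cw \<theta> - 1) \<le> \<theta>" "norm (cw \<theta> - 1) \<le> 1"
proof -
  show "norm (cw \<theta> - 1) \<le> \<theta>"
    unfolding cw_minus_1 using norm_cw_le_1[of \<theta>] assms by (simp add: norm_mult mult_left_le)
  have "\<theta> \<le> sqrt (1 + \<theta>\<^sup>2)" using assms by (intro real_le_rsqrt) simp
  then show "norm (cw \<theta> - 1) \<le> 1"
    unfolding cw_minus_1 using assms by (simp add: norm_mult norm_cw divide_le_eq_1 add_pos_nonneg)
qed

lemma Ti_ratio_half: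
  assumes "a \<ge> 4" "\<theta> > 0"
  shows "norm (Ti_ratio a \<theta> - 1) < 1 / 2"
proof -
  have "norm (cw \<theta> - 1) / (a - 1) \<le> 1 / 3"
    using norm_cw_minus_1[OF assms(2)] assms by (intro frac_le) auto
  then show ?thesis using Ti_ratio_near_1[of a \<theta>] assms by linarith
qed

lemma Ti_phase_eq:
  assumes "a \<ge> 4" "\<theta> > 0"
  shows "Ti_phase a \<theta> = a * \<theta> - arctan \<theta> + Im (Ln (Ti_ratio a \<theta>))"
proof -
  have K: "norm (Ti_ratio a \<theta> - 1) < 1 / 2" by (rule Ti_ratio_half[OF assms])
  then have nz: "Ti_ratio a \<theta> \<noteq> 0" by auto
  have "\<bar>Re (Ti_ratio a \<theta> - 1)\<bar> < 1 / 2" using K abs_Re_le_cmod order_le_less_trans by blast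
  then have "0 < Re (Ti_ratio a \<theta>)" unfolding minus_complex.sel one_complex.sel by linarith
  then have "\<bar>Im (Ln (Ti_ratio a \<theta>))\<bar> < pi / 2" by (rule Re_Ln_pos_lt_imp)
  then have "Ln (cw \<theta> * Ti_ratio a \<theta>) = Ln (cw \<theta>) + Ln (Ti_ratio a \<theta>)"
    using arctan_lbound[of \<theta>] arctan_ubound[of \<theta>]
    by (intro Ln_times_simple cw_nonzero nz) (auto simp: Im_Ln_cw abs_less_iff)
  moreover have "cw \<theta> * Ti_ratio a \<theta> = Ti_amplitude a \<theta>"
    using cw_nonzero[of \<theta>] by (simp add: Ti_ratio_def)
  ultimately show ?thesis by (simp add: Ti_phase_def Im_Ln_cw)
qed

text \<open>
  Near \<theta> = 0 the estimate of K has to be proportional to \<theta>, which is the case because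
  |w - 1| is at most \<theta>.
\<close>
lemma Ti_phase_pos:
  assumes "a \<ge> 4" "\<theta> > 0"
  shows "Ti_phase a \<theta> > 0"
proof -
  have "norm (Ln (1 + (Ti_ratio a \<theta> - 1))) \<le> 2 * norm (Ti_ratio a \<theta> - 1)"
    by (rule norm_Ln_le) (rule Ti_ratio_half[OF assms])
  also have "\<dots> \<le> 2 * (\<theta> / 3)"
  proof -
    have "norm (cw \<theta> - 1) / (a - 1) \<le> \<theta> / 3"
      using norm_cw_minus_1[OF assms(2)] assms by (intro frac_le) auto
    then show ?thesis using Ti_ratio_near_1[of a \<theta>] assms by linarith
  qed
  finally have "\<bar>Im (Ln (Ti_ratio a \<theta>))\<bar> \<le> 2 * (\<theta> / 3)"
    using abs_Im_le_cmod[of "Ln (Ti_ratio a \<theta>)"] by simp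
  moreover have "arctan \<theta> \<le> \<theta>" by (rule arctan_le_self) (use assms in simp)
  moreover have "4 * \<theta> \<le> a * \<theta>" using assms by simp
  ultimately show ?thesis unfolding Ti_phase_eq[OF assms] using assms by linarith
qed

lemma Ti_phase_surj:
  assumes "a \<ge> 4" "v > 0"
  shows "\<exists>\<theta>>0. Ti_phase a \<theta> = v"
proof -
  have *: "a * \<theta> - pi < Ti_phase a \<theta>" "Ti_phase a \<theta> < a * \<theta>" if "\<theta> > 0" for \<theta>
  proof -
    have im: "Im (Ti_amplitude a \<theta>) < 0" by (rule Im_Ti_amplitude_neg) (use that assms in auto)
    then have "Ti_amplitude a \<theta> \<noteq> 0" by auto
    then show "a * \<theta> - pi < Ti_phase a \<theta>" "Ti_phase a \<theta> < a * \<theta>"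
      using mpi_less_Im_Ln[of "Ti_amplitude a \<theta>"] Im_Ln_le_pi[of "Ti_amplitude a \<theta>"] im Im_Ln_pos_le[of "Ti_amplitude a \<theta>"]
      unfolding Ti_phase_def by auto
  qed
  have "\<exists>\<theta>. v / a \<le> \<theta> \<and> \<theta> \<le> (v + pi) / a \<and> Ti_phase a \<theta> = v"
  proof (rule IVT)
    (* the argument of Ti_amplitude lies strictly between -\<pi> and 0 *)
    show "Ti_phase a (v / a) \<le> v" using *(2)[of "v / a"] assms by simp
    show "v \<le> Ti_phase a ((v + pi) / a)" using *(1)[of "(v + pi) / a"] assms pi_gt_zero by (simp add: add_pos_pos)
    show "v / a \<le> (v + pi) / a" using assms by (simp add: divide_right_mono)
    show "\<forall>x. v / a \<le> x \<and> x \<le> (v + pi) / a \<longrightarrow> isCont (Ti_phase a) x"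
    proof (intro allI impI)
      fix x assume "v / a \<le> x \<and> x \<le> (v + pi) / a"
      moreover have "0 < v / a" using assms by simp
      ultimately have "x > 0" by linarith
      then show "isCont (Ti_phase a) x" using Ti_phase_deriv[of a x] assms by (auto intro: DERIV_isCont)
    qed
  qed
  then obtain \<theta> where \<theta>: "v / a \<le> \<theta>" "Ti_phase a \<theta> = v" by blast
  have "0 < v / a" using assms by simp
  then have "0 < \<theta>" using \<theta>(1) by linarith
  then show ?thesis using \<theta>(2) by blast
qed

lemma strict_mono_enumeration_unique:
  fixes t t' :: "nat \<Rightarrow> 'a::linorder"
  assumes "strict_mono t" "strict_mono t'" "t 0 = t' 0" "t ` {1..} = t' ` {1..}"
  shows "t = t'"
proof -
  have le: "f m \<le> g m" if fg: "strict_mono f" "strict_mono g" "f 0 = g 0" "f ` {1..} = g ` {1..}"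
    for f g :: "nat \<Rightarrow> 'a" and m
  proof -
    have "\<exists>j. g m = f j" for m
    proof (cases "m = 0")
      case False
      then have "g m \<in> f ` {1..}" unfolding fg(4) by (intro imageI) auto
      then show ?thesis by blast
    qed (use fg(3) in metis)
    then obtain \<sigma> where \<sigma>: "\<And>m. g m = f (\<sigma> m)" by metis
    have "strict_mono \<sigma>"
      using fg(1,2) unfolding strict_mono_def by (metis \<sigma> fg(1) strict_mono_less)
    then have "m \<le> \<sigma> m" by (rule strict_mono_imp_increasing)
    then show ?thesis unfolding \<sigma> using fg(1) by (simp add: strict_mono_less_eq)
  qed
  show ?thesis
    using le[of t t'] le[of t' t] assms by (intro ext antisym) auto
qed

text \<open>
  The positive zeros are the points where Ti_phase takes one of the values (k + \<alpha> - 1/2)\<pi>.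
  As the phase increases from 0 to infinity, each positive value of this form is attained exactly
  once, and the smallest such value belongs to k = 1 or to k = 0 according to l_shift.
\<close>
lemma Ti_zero_phase:
  assumes a: "a \<ge> 4" and \<alpha>: "0 \<le> \<alpha>" "\<alpha> < 1" and m: "m \<ge> 1"
  shows "Ti_zero \<alpha> a m > 0 \<and>
    Ti_phase a (Ti_zero \<alpha> a m) = (real m - l_shift \<alpha> + \<alpha> - 1 / 2) * pi"
proof -
  define v where "v = (\<lambda>m. (real m - l_shift \<alpha> + \<alpha> - 1 / 2) * pi)"
  have v_pos: "v m > 0" if "m \<ge> 1" for m
    unfolding v_def l_shift_def using that \<alpha> by (auto intro!: mult_pos_pos)
  have a2: "a > 2" using a by simp
  have mono_iff: "Ti_phase a x < Ti_phase a y \<longleftrightarrow> x < y" if "x > 0" "y > 0" for x y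
    using Ti_phase_strict_mono[OF a2, of x y] Ti_phase_strict_mono[OF a2, of y x] that
    by (cases x y rule: linorder_cases) auto
  have "\<exists>t. \<forall>m\<ge>1. t m > 0 \<and> Ti_phase a (t m) = v m"
    using Ti_phase_surj[OF a v_pos] by metis
  then obtain t0 where t0: "\<And>m. m \<ge> 1 \<Longrightarrow> t0 m > 0" "\<And>m. m \<ge> 1 \<Longrightarrow> Ti_phase a (t0 m) = v m" by blast
  define t where "t = (\<lambda>m. if m = 0 then 0 else t0 m)"
  have t: "t m > 0" "Ti_phase a (t m) = v m" if "m \<ge> 1" for m using t0 that by (auto simp: t_def)
  have mono: "strict_mono t"
    unfolding strict_mono_Suc_iff
  proof
    fix n
    show "t n < t (Suc n)"
    proof (cases "n = 0")
      case False
      have "v n < v (Suc n)" by (simp add: v_def)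
      then show ?thesis using t[of n] t[of "Suc n"] False mono_iff[of "t n" "t (Suc n)"] by simp
    qed (use t[of 1] in \<open>simp add: t_def\<close>)
  qed
  have image: "t ` {1..} = {\<theta>. \<theta> > 0 \<and> Ti_fun a (a * \<theta>) \<alpha> = 0}"
  proof (intro equalityI subsetI)
    fix \<theta> assume "\<theta> \<in> t ` {1..}"
    then obtain m where m: "m \<ge> 1" and \<theta>: "\<theta> = t m" by auto
    have "Ti_phase a (t m) = (of_int (int m - (if \<alpha> \<le> 1 / 2 then 0 else 1)) + \<alpha> - 1 / 2) * pi"
      using t(2)[OF m] by (simp add: v_def l_shift_def)
    then have "Ti_fun a (a * t m) \<alpha> = 0" unfolding Ti_zero_iff_phase[OF a2 t(1)[OF m]] by blast
    then show "\<theta> \<in> {\<theta>. \<theta> > 0 \<and> Ti_fun a (a * \<theta>) \<alpha> = 0}" using t(1)[OF m] by (simp add: \<theta>)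
  next
    fix \<theta> assume "\<theta> \<in> {\<theta>. \<theta> > 0 \<and> Ti_fun a (a * \<theta>) \<alpha> = 0}"
    then have \<theta>: "\<theta> > 0" "Ti_fun a (a * \<theta>) \<alpha> = 0" by auto
    then obtain k :: int where k: "Ti_phase a \<theta> = (of_int k + \<alpha> - 1 / 2) * pi"
      unfolding Ti_zero_iff_phase[OF a2 \<theta>(1)] by blast
    have "0 < (of_int k + \<alpha> - 1 / 2) * pi" unfolding k[symmetric] by (rule Ti_phase_pos[OF a \<theta>(1)])
    then have k0: "0 < of_int k + \<alpha> - 1 / 2" by (simp add: zero_less_mult_iff)
    define m where "m = nat (k + (if \<alpha> \<le> 1 / 2 then 0 else 1))"
    have k1: "k + (if \<alpha> \<le> 1 / 2 then 0 else 1) \<ge> 1"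
    proof (cases "\<alpha> \<le> 1 / 2")
      case True
      with k0 have "0 < real_of_int k" by linarith
      then show ?thesis using True by simp
    next
      case False
      from k0 \<alpha> have "- 1 < real_of_int k" by linarith
      then show ?thesis using False by simp
    qed
    then have m: "m \<ge> 1" "real m = of_int k + l_shift \<alpha>" by (auto simp: m_def l_shift_def)
    have "Ti_phase a \<theta> = Ti_phase a (t m)" using k t(2)[OF m(1)] m(2) by (simp add: v_def)
    then have "\<theta> = t m"
      using mono_iff[of \<theta> "t m"] mono_iff[of "t m" \<theta>] \<theta>(1) t(1)[OF m(1)] by (metis less_irrefl linorder_neqE)
    then show "\<theta> \<in> t ` {1..}" using m(1) by auto
  qed
  have "Ti_zero \<alpha> a = t"
    unfolding Ti_zero_def
  proof (rule the_equality)
    show "strict_mono t \<and> t 0 = 0 \<and> t ` {1..} = {\<theta>. \<theta> > 0 \<and> Ti_fun a (a * \<theta>) \<alpha> = 0}"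
      using mono image by (simp add: t_def)
    fix t' :: "nat \<Rightarrow> real" assume t': "strict_mono t' \<and> t' 0 = 0 \<and> t' ` {1..} = {\<theta>. \<theta> > 0 \<and> Ti_fun a (a * \<theta>) \<alpha> = 0}"
    show "t' = t"
      by (rule strict_mono_enumeration_unique) (use t' mono image in \<open>simp_all add: t_def\<close>)
  qed
  then show ?thesis using t[OF m] by (simp add: v_def)
qed

lemma t_approx_eq:
  assumes a: "a > 1" and \<alpha>: "0 \<le> \<alpha>" "\<alpha> < 1" and m: "m \<ge> 1"
  shows "a * t_approx \<alpha> a m - arctan (t_approx \<alpha> a m) = (real m - l_shift \<alpha> + \<alpha> - 1 / 2) * pi"
proof -
  define v where "v = (real m - l_shift \<alpha> + \<alpha> - 1 / 2) * pi"
  have v: "v > 0"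
    unfolding v_def l_shift_def using m \<alpha> by (auto intro!: mult_pos_pos)
  let ?f = "\<lambda>\<theta>. a * \<theta> - arctan \<theta>"
  have mono: "?f x < ?f y" if "x < y" for x y
  proof (rule DERIV_pos_imp_increasing[OF that])
    fix t :: real
    have "inverse (1 + t\<^sup>2) \<le> 1" using le_imp_inverse_le[of 1 "1 + t\<^sup>2"] by simp
    then have "0 < a - inverse (1 + t\<^sup>2)" using a by linarith
    moreover have "(?f has_real_derivative a - inverse (1 + t\<^sup>2)) (at t)"
      by (auto intro!: derivative_eq_intros)
    ultimately show "\<exists>y. (?f has_real_derivative y) (at t) \<and> 0 < y" by blast
  qed
  have "\<exists>\<theta>. 0 \<le> \<theta> \<and> \<theta> \<le> (v + pi) / a \<and> ?f \<theta> = v"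
  proof (rule IVT)
    show "v \<le> ?f ((v + pi) / a)" using arctan_ubound[of "(v + pi) / a"] a
      by (simp, use pi_gt_zero in linarith)
    show "0 \<le> (v + pi) / a" using v a pi_gt_zero by simp
  qed (use v in \<open>auto intro!: continuous_intros\<close>)
  then obtain \<theta> where \<theta>: "0 \<le> \<theta>" "?f \<theta> = v" by blast
  then have "\<theta> > 0" using v by (cases "\<theta> = 0") auto
  have "t_approx \<alpha> a m = \<theta>"
    unfolding t_approx_def v_def[symmetric]
  proof (rule the_equality)
    show "\<theta> > 0 \<and> ?f \<theta> = v" using \<theta> \<open>\<theta> > 0\<close> by simp
    fix x assume "x > 0 \<and> ?f x = v"
    then show "x = \<theta>" using mono[of x \<theta>] mono[of \<theta> x] \<theta>(2) by (cases x \<theta> rule: linorder_cases) auto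
  qed
  then show ?thesis using \<theta>(2) by (simp add: v_def)
qed

section \<open>Expansion of the phase\<close>

text \<open>
  Quotients by w(w - 1), which let the weight of the comparison lemma be split off. The value 0 at
  n = 0 accounts for the fact that only recip_coeff n with n positive is divisible.
\<close>
definition recip_quot :: "nat \<Rightarrow> complex poly" where
  "recip_quot n = (if n = 0 then 0 else recip_coeff n div [:0, -1, 1:])"

lemma recip_quot: "n \<ge> 1 \<Longrightarrow> [:0, -1, 1:] * recip_quot n = recip_coeff n"
proof -
  assume "n \<ge> 1"
  then have "[:0, -1, 1:] dvd recip_coeff n" "recip_quot n = recip_coeff n div [:0, -1, 1:]"
    using recip_coeff_dvd1[of "n - 1"] by (simp_all add: recip_quot_def)
  then show ?thesis by (simp only: dvd_mult_div_cancel)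
qed

lemma recip_quot_0: "recip_quot 0 = 0"
  by (simp add: recip_quot_def)

lemma recip_coeff_Suc:
  assumes "n \<ge> 1"
  shows "recip_coeff (Suc n) = - [:0, 0, -1, 1:] * pderiv (recip_coeff n)
     - (\<Sum>j\<in>{2..n}. recip_coeff j * recip_coeff (Suc n - j))"
  using assms by (cases n) (auto simp del: mult_minus_left)

text \<open>
  The coefficient of (1/a)^(n+1) in the Riccati equation of 1/K, divided by w(w - 1).
\<close>
lemma recip_ode:
  "recip_coeff n - [:0, 1:] * pderiv (recip_coeff n)
     = (\<Sum>j\<le>n. recip_coeff j * recip_quot (Suc n - j))"
proof -
  let ?m = recip_coeff and ?p = "[:0, -1, 1:] :: complex poly"
  have "?p * (\<Sum>j\<le>n. ?m j * recip_quot (Suc n - j)) = (\<Sum>j\<le>n. ?m j * ?m (Suc n - j))"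
    unfolding sum_distrib_left
    by (intro sum.cong refl) (simp only: mult.left_commute recip_quot Suc_diff_le atMost_iff le_add1 One_nat_def Suc_le_mono zero_le)
  also have "\<dots> = ?p * (?m n - [:0, 1:] * pderiv (?m n))"
  proof (cases "n = 0")
    case False
    then have n: "n \<ge> 1" by simp
    have "{..n} = insert 0 (insert 1 {2..n})" using n by auto
    then have "(\<Sum>j\<le>n. ?m j * ?m (Suc n - j)) = ?m (Suc n) + (?m 1 * ?m n + (\<Sum>j\<in>{2..n}. ?m j * ?m (Suc n - j)))"
      by (simp del: recip_coeff.simps(2,3))
    also have "\<dots> = ?m 1 * ?m n - [:0, 0, -1, 1:] * pderiv (?m n)"
      unfolding recip_coeff_Suc[OF n] by simp
    also have "[:0, 0, -1, 1:] = ?p * [:0, 1:]" by simp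
    finally show ?thesis by (simp add: algebra_simps del: mult_pCons_left mult_pCons_right)
  qed simp
  finally show ?thesis by (subst (asm) mult_left_cancel) auto
qed

text \<open>
  The derivative with respect to w of 1/K is -1/K times that of log K, coefficient by coefficient. So
  the phase coefficients, which integrate F_minus, are the coefficients of log K.
\<close>
lemma recip_log_derivative:
  "pderiv (recip_coeff n) + (\<Sum>s\<in>{1..n}. pderiv (phase_coeff s) * recip_coeff (n - s)) = 0"
proof (cases "n = 0")
  case False
  then have n: "n \<ge> 1" by simp
  let ?m = recip_coeff and ?D = "[:0, 0, -1, 1:] :: complex poly"
  have "?D * (\<Sum>s\<in>{1..n}. pderiv (phase_coeff s) * ?m (n - s)) = (\<Sum>s\<in>{1..n}. ?m (Suc s) * ?m (n - s))"
    unfolding sum_distrib_left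
    by (intro sum.cong refl) (simp only: mult.assoc[symmetric] pderiv_phase_coeff atLeastAtMost_iff)
  also have "\<dots> = (\<Sum>j\<in>{2..Suc n}. ?m j * ?m (Suc n - j))"
    by (rule sum.reindex_bij_witness[of _ "\<lambda>j. j - 1" Suc]) auto
  also have "\<dots> = ?m (Suc n) + (\<Sum>j\<in>{2..n}. ?m j * ?m (Suc n - j))"
    using n by (subst sum.nat_ivl_Suc') (auto simp del: recip_coeff.simps(2,3))
  also have "\<dots> = - (?D * pderiv (?m n))"
    unfolding recip_coeff_Suc[OF n] by simp
  finally have "?D * (pderiv (?m n) + (\<Sum>s\<in>{1..n}. pderiv (phase_coeff s) * ?m (n - s))) = 0"
    by (simp only: distrib_left add.right_inverse)
  then show ?thesis by (simp only: mult_eq_0_iff) simp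
qed simp

definition eps_poly :: "(nat \<Rightarrow> complex poly) \<Rightarrow> nat \<Rightarrow> complex \<Rightarrow> real \<Rightarrow> complex" where
  "eps_poly p N w \<epsilon> = (\<Sum>k\<le>N. poly (p k) w * of_real \<epsilon> ^ k)"

lemma expands_eps_poly:
  "expands (cball 0 1) N (\<lambda>w. Abs_fps (\<lambda>k. poly (p k) w)) (eps_poly p N)"
proof -
  have "expands (cball 0 1) N (\<lambda>w. Abs_fps (\<lambda>k. poly (p k) w))
      (\<lambda>w \<epsilon>. \<Sum>k\<le>N. Abs_fps (\<lambda>k. poly (p k) w) $ k * of_real \<epsilon> ^ k)"
  proof (rule expands_polynomial)
    fix k
    obtain C where "\<And>w. norm w \<le> 1 \<Longrightarrow> norm (poly (p k) w) \<le> C"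
      by (rule poly_bounded_on_disc) (rule that)
    then show "\<exists>C. \<forall>w\<in>cball 0 1. norm (Abs_fps (\<lambda>k. poly (p k) w) $ k) \<le> C"
      by (intro exI[of _ C]) simp
  qed
  then show ?thesis by (simp add: eps_poly_def[abs_def])
qed

lemma DERIV_eps_poly:
  "((\<lambda>w. eps_poly p N w \<epsilon>) has_field_derivative eps_poly (\<lambda>k. pderiv (p k)) N w \<epsilon>) (at w within S)"
  unfolding eps_poly_def by (auto intro!: derivative_eq_intros has_field_derivative_at_within[OF poly_DERIV])

definition phase_poly :: "nat \<Rightarrow> complex poly" where
  "phase_poly s = (if s = 0 then 0 else phase_coeff s)"

abbreviation "recip_sum \<equiv> eps_poly recip_coeff"
abbreviation "phase_sum \<equiv> eps_poly phase_poly"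

lemma recip_sum_eq:
  "recip_sum N w \<epsilon> = 1 + w * (w - 1) * eps_poly recip_quot N w \<epsilon>"
proof -
  have coeff: "poly (recip_coeff k) w = (if k = 0 then 1 else 0) + w * (w - 1) * poly (recip_quot k) w" for k
  proof (cases "k = 0")
    case False
    then have "recip_coeff k = [:0, -1, 1:] * recip_quot k" by (simp only: recip_quot One_nat_def Suc_le_eq neq0_conv)
    then show ?thesis using False by (simp only: poly_mult) (simp add: algebra_simps)
  qed (simp add: recip_quot_0)
  have "recip_sum N w \<epsilon> = (\<Sum>k\<le>N. (if k = 0 then 1 else 0) * of_real \<epsilon> ^ k) + w * (w - 1) * eps_poly recip_quot N w \<epsilon>"
    unfolding eps_poly_def sum_distrib_left sum.distrib[symmetric]
    by (intro sum.cong refl) (subst coeff, simp only: distrib_right mult.assoc)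
  also have "(\<Sum>k\<le>N. (if k = 0 then 1 else 0) * of_real \<epsilon> ^ k) = (\<Sum>k\<in>{0}. (if k = 0 then 1 else 0) * of_real \<epsilon> ^ k :: complex)"
    by (rule sum.mono_neutral_right) auto
  finally show ?thesis by simp
qed

text \<open>
  The left-hand side vanishes formally to all orders, so truncation leaves an error of order N + 1.
\<close>
lemma recip_residual:
  obtains C where "C \<ge> 0" "\<And>w \<epsilon>. norm w \<le> 1 \<Longrightarrow> 0 < \<epsilon> \<Longrightarrow> \<epsilon> \<le> 1 \<Longrightarrow>
    norm (of_real \<epsilon> * (recip_sum N w \<epsilon> - w * eps_poly (\<lambda>k. pderiv (recip_coeff k)) N w \<epsilon>)
      - recip_sum N w \<epsilon> * eps_poly recip_quot N w \<epsilon>) \<le> C * \<epsilon> ^ Suc N"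
proof -
  let ?M = "\<lambda>w. Abs_fps (\<lambda>k. poly (recip_coeff k) w)"
  let ?M' = "\<lambda>w. Abs_fps (\<lambda>k. poly (pderiv (recip_coeff k)) w)"
  let ?Q = "\<lambda>w. Abs_fps (\<lambda>k. poly (recip_quot k) w)"
  have w: "expands (cball 0 1) N (\<lambda>w. fps_const w) (\<lambda>w \<epsilon>. w)"
    by (rule expands_const[where C = 1]) auto
  have "expands (cball 0 1) N (\<lambda>w. fps_X * (?M w - fps_const w * ?M' w) - ?M w * ?Q w)
     (\<lambda>w \<epsilon>. of_real \<epsilon> * (recip_sum N w \<epsilon> - w * eps_poly (\<lambda>k. pderiv (recip_coeff k)) N w \<epsilon>)
      - recip_sum N w \<epsilon> * eps_poly recip_quot N w \<epsilon>)"
    by (intro expands_diff expands_mult expands_X expands_eps_poly w)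
  moreover have "(fps_X * (?M w - fps_const w * ?M' w) - ?M w * ?Q w) $ n = 0" for w n
  proof (cases n)
    case 0
    then show ?thesis by (simp add: recip_quot_0)
  next
    case (Suc k)
    have "(?M w * ?Q w) $ Suc k = (\<Sum>j\<le>Suc k. poly (recip_coeff j) w * poly (recip_quot (Suc k - j)) w)"
      by (simp only: fps_mult_nth Abs_fps_inverse fps_nth_Abs_fps atMost_atLeast0)
    also have "\<dots> = poly (\<Sum>j\<le>k. recip_coeff j * recip_quot (Suc k - j)) w"
      by (simp add: recip_quot_0 poly_sum)
    also have "\<dots> = poly (recip_coeff k) w - w * poly (pderiv (recip_coeff k)) w"
      unfolding recip_ode[symmetric] by simp
    finally show ?thesis unfolding Suc by simp
  qed
  ultimately show thesis by (rule expands_coeff_zero) (use that in auto)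
qed

text \<open>
  The truncations of 1/K and of log K match without any computation with logarithms of power series:
  the product is 1 at w = 1, and its derivative in w is small by recip_log_derivative, so it is close
  to 1 on the whole disc.
\<close>
lemma recip_times_exp_phase:
  obtains C where "C \<ge> 0" "\<And>w \<epsilon>. norm w \<le> 1 \<Longrightarrow> 0 < \<epsilon> \<Longrightarrow> \<epsilon> \<le> 1 \<Longrightarrow>
    norm (recip_sum N w \<epsilon> * exp (phase_sum N w \<epsilon>) - 1) \<le> C * \<epsilon> ^ Suc N"
proof -
  let ?M = "\<lambda>w. Abs_fps (\<lambda>k. poly (recip_coeff k) w)"
  let ?M' = "\<lambda>w. Abs_fps (\<lambda>k. poly (pderiv (recip_coeff k)) w)"
  let ?P' = "\<lambda>w. Abs_fps (\<lambda>k. poly (pderiv (phase_poly k)) w)"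
  let ?M'v = "eps_poly (\<lambda>k. pderiv (recip_coeff k)) N"
  let ?P'v = "eps_poly (\<lambda>k. pderiv (phase_poly k)) N"
  have "expands (cball 0 1) N (\<lambda>w. ?M' w + ?P' w * ?M w) (\<lambda>w \<epsilon>. ?M'v w \<epsilon> + ?P'v w \<epsilon> * recip_sum N w \<epsilon>)"
    by (intro expands_add expands_mult expands_eps_poly)
  moreover have "(?M' w + ?P' w * ?M w) $ n = 0" for w n
  proof -
    have "(?P' w * ?M w) $ n = (\<Sum>s\<in>{0..n}. poly (pderiv (phase_poly s)) w * poly (recip_coeff (n - s)) w)"
      by (simp add: fps_mult_nth)
    also have "\<dots> = (\<Sum>s\<in>{1..n}. poly (pderiv (phase_poly s)) w * poly (recip_coeff (n - s)) w)"
      by (rule sum.mono_neutral_right) (auto simp: phase_poly_def not_le)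
    also have "\<dots> = poly (\<Sum>s\<in>{1..n}. pderiv (phase_coeff s) * recip_coeff (n - s)) w"
      unfolding poly_sum poly_mult by (intro sum.cong) (auto simp: phase_poly_def)
    finally have "(?M' w + ?P' w * ?M w) $ n =
       poly (pderiv (recip_coeff n) + (\<Sum>s\<in>{1..n}. pderiv (phase_coeff s) * recip_coeff (n - s))) w"
      by simp
    then show ?thesis unfolding recip_log_derivative by simp
  qed
  ultimately obtain C where C: "C \<ge> 0" "\<And>w \<epsilon>. norm w \<le> 1 \<Longrightarrow> 0 < \<epsilon> \<Longrightarrow> \<epsilon> \<le> 1 \<Longrightarrow>
      norm (?M'v w \<epsilon> + ?P'v w \<epsilon> * recip_sum N w \<epsilon>) \<le> C * \<epsilon> ^ Suc N"
    by (rule expands_coeff_zero) auto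
  obtain L where L: "L \<ge> 0" "\<And>w \<epsilon>. norm w \<le> 1 \<Longrightarrow> 0 < \<epsilon> \<Longrightarrow> \<epsilon> \<le> 1 \<Longrightarrow> norm (phase_sum N w \<epsilon>) \<le> L"
    by (rule expands_bounded[OF expands_eps_poly[of N phase_poly]]) auto
  show thesis
  proof (rule that)
    fix w :: complex and \<epsilon> :: real assume *: "norm w \<le> 1" "0 < \<epsilon>" "\<epsilon> \<le> 1"
    let ?G = "\<lambda>w. recip_sum N w \<epsilon> * exp (phase_sum N w \<epsilon>)"
    have "norm (?G w - ?G 1) \<le> (exp L * (C * \<epsilon> ^ Suc N)) * norm (w - 1)"
    proof (rule field_differentiable_bound[of "cball 0 1"])
      fix z :: complex assume "z \<in> cball 0 1"
      then have z: "norm z \<le> 1" by simp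
      show "(?G has_field_derivative exp (phase_sum N z \<epsilon>) * (?M'v z \<epsilon> + ?P'v z \<epsilon> * recip_sum N z \<epsilon>))
          (at z within cball 0 1)"
        by (rule derivative_eq_intros DERIV_eps_poly refl)+ (simp add: algebra_simps)
      show "norm (exp (phase_sum N z \<epsilon>) * (?M'v z \<epsilon> + ?P'v z \<epsilon> * recip_sum N z \<epsilon>)) \<le> exp L * (C * \<epsilon> ^ Suc N)"
        unfolding norm_mult
      proof (rule mult_mono[OF _ C(2)[OF z *(2,3)]])
        have "norm (exp (phase_sum N z \<epsilon>)) \<le> exp (norm (phase_sum N z \<epsilon>))" by (rule norm_exp)
        also have "\<dots> \<le> exp L" using L(2)[OF z *(2,3)] by simp
        finally show "norm (exp (phase_sum N z \<epsilon>)) \<le> exp L" .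
      qed auto
    qed (use * in auto)
    also have "?G 1 = 1"
    proof -
      have "recip_sum N 1 \<epsilon> = 1" by (simp add: recip_sum_eq)
      moreover have "phase_sum N 1 \<epsilon> = 0" by (auto simp: eps_poly_def phase_poly_def phase_coeff(2) intro!: sum.neutral)
      ultimately show ?thesis by simp
    qed
    also have "(exp L * (C * \<epsilon> ^ Suc N)) * norm (w - 1) \<le> (exp L * (C * \<epsilon> ^ Suc N)) * 2"
      using norm_triangle_ineq4[of w 1] * C(1) by (intro mult_left_mono) auto
    finally show "norm (?G w - 1) \<le> (exp L * C * 2) * \<epsilon> ^ Suc N" by (simp add: algebra_simps)
  qed (use C in auto)
qed

lemma recip_sum_near_1:
  obtains C where "C \<ge> 0" "\<And>w \<epsilon>. norm w \<le> 1 \<Longrightarrow> 0 < \<epsilon> \<Longrightarrow> \<epsilon> \<le> 1 \<Longrightarrow> norm (recip_sum N w \<epsilon> - 1) \<le> C * \<epsilon>"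
proof -
  have "expands (cball 0 1) N (\<lambda>w. Abs_fps (\<lambda>k. poly (recip_coeff k) w) - fps_const 1) (\<lambda>w \<epsilon>. recip_sum N w \<epsilon> - 1)"
    by (intro expands_diff expands_eps_poly expands_const[where C = 1]) auto
  then show thesis by (rule expands_small) (use that in auto)
qed

lemma phase_sum_small:
  obtains C where "C \<ge> 0" "\<And>w \<epsilon>. norm w \<le> 1 \<Longrightarrow> 0 < \<epsilon> \<Longrightarrow> \<epsilon> \<le> 1 \<Longrightarrow> norm (phase_sum N w \<epsilon>) \<le> C * \<epsilon>"
  by (rule expands_small[OF expands_eps_poly[of N phase_poly]]) (use that in \<open>auto simp: phase_poly_def\<close>)

text \<open>
  The comparison lemma is applied to S = w/M, where M is the truncated expansion of 1/K.
\<close>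
lemma Ti_ratio_expansion:
  obtains C A where "A \<ge> 2" "C \<ge> 0"
    "\<And>a \<theta>. a \<ge> A \<Longrightarrow> \<theta> > 0 \<Longrightarrow>
       norm (Ti_ratio a \<theta> * recip_sum N (cw \<theta>) (1 / a) - 1) \<le> C * (1 / a) ^ Suc N"
proof -
  let ?M' = "eps_poly (\<lambda>k. pderiv (recip_coeff k)) N"
  obtain B where B: "B \<ge> 0" "\<And>w \<epsilon>. norm w \<le> 1 \<Longrightarrow> 0 < \<epsilon> \<Longrightarrow> \<epsilon> \<le> 1 \<Longrightarrow> norm (recip_sum N w \<epsilon> - 1) \<le> B * \<epsilon>"
    by (rule recip_sum_near_1) (rule that)
  obtain C where C: "C \<ge> 0" "\<And>w \<epsilon>. norm w \<le> 1 \<Longrightarrow> 0 < \<epsilon> \<Longrightarrow> \<epsilon> \<le> 1 \<Longrightarrow>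
    norm (of_real \<epsilon> * (recip_sum N w \<epsilon> - w * ?M' w \<epsilon>)
      - recip_sum N w \<epsilon> * eps_poly recip_quot N w \<epsilon>) \<le> C * \<epsilon> ^ Suc N"
    by (rule recip_residual) (rule that)
  show thesis
  proof (rule that[of "max 2 (2 * B)" "16 * C"])
    fix a \<theta> :: real assume "a \<ge> max 2 (2 * B)" and \<theta>: "\<theta> > 0"
    then have a: "a \<ge> 2" "a \<ge> 2 * B" by auto
    define \<epsilon> where "\<epsilon> = 1 / a"
    have e: "0 < \<epsilon>" "\<epsilon> \<le> 1" "a * \<epsilon> = 1" "B * \<epsilon> \<le> 1 / 2" using a by (auto simp: \<epsilon>_def field_simps)
    let ?M = "\<lambda>t. recip_sum N (cw t) \<epsilon>"
    have near: "norm (?M t - 1) \<le> 1 / 2" for t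
      using B(2)[OF norm_cw_le_1 e(1,2)] e(4) by (meson order_trans)
    have up: "norm (?M t) \<le> 2" for t
      using near[of t] norm_triangle_sub[of "?M t" 1] by simp
    have low: "1 / 2 \<le> norm (?M t)" for t
      using near[of t] norm_triangle_ineq2[of 1 "1 - ?M t"] by (simp add: norm_minus_commute)
    have nz: "?M t \<noteq> 0" for t using low[of t] by auto
    define S where "S = (\<lambda>t. cw t / ?M t)"
    define S' where "S' = (\<lambda>t. - \<i> * (cw t)\<^sup>2 * (?M t - cw t * ?M' (cw t) \<epsilon>) / (?M t)\<^sup>2)"
    have "norm (Ti_amplitude a \<theta> - S \<theta>) \<le> (4 * C * \<epsilon> ^ N) / (a - 1) * (norm (cw \<theta>) * norm (cw \<theta> - 1))"
    proof (rule Ti_amplitude_comparison[where S' = S'])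
      fix t :: real assume "t \<ge> 0"
      have "((\<lambda>w. w / recip_sum N w \<epsilon>) has_field_derivative
          (?M t - cw t * ?M' (cw t) \<epsilon>) / (?M t)\<^sup>2) (at (cw t))"
        by (rule DERIV_cong, rule DERIV_divide[OF DERIV_ident DERIV_eps_poly nz])
          (simp add: power2_eq_square)
      from field_vector_diff_chain_at[OF cw_has_vector_derivative this]
      show "(S has_vector_derivative S' t) (at t)" by (simp add: S_def S'_def o_def)
    next
      fix t :: real assume "t > 0"
      let ?r = "of_real \<epsilon> * (?M t - cw t * ?M' (cw t) \<epsilon>) - ?M t * eps_poly recip_quot N (cw t) \<epsilon>"
      (* With 1 = a / a the residual becomes a multiple of the bracket bounded by C. *)
      have ae: "of_real a * of_real \<epsilon> = (1 :: complex)" using e(3) by (metis of_real_1 of_real_mult)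
      have "of_real t * S' t = (- \<i> * of_real t * cw t) * cw t * (?M t - cw t * ?M' (cw t) \<epsilon>) / (?M t)\<^sup>2"
        by (simp add: S'_def power2_eq_square)
      then have 1: "of_real t * S' t = cw t * (cw t - 1) * (?M t - cw t * ?M' (cw t) \<epsilon>) / (?M t)\<^sup>2"
        unfolding cw_minus_1[symmetric] by (simp add: mult.commute)
      have 2: "of_real a / cw t * S t - of_real a = of_real a * (?M t * (1 - ?M t)) / (?M t)\<^sup>2"
        using nz[of t] cw_nonzero[of t] by (simp add: S_def field_simps power2_eq_square)
      have 3: "1 - ?M t = - (cw t * (cw t - 1) * eps_poly recip_quot N (cw t) \<epsilon>)"
        by (simp add: recip_sum_eq)
      have "of_real t * S' t + of_real a / cw t * S t - of_real a
        = of_real t * S' t + (of_real a / cw t * S t - of_real a)" by simp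
      also have "\<dots> = (cw t * (cw t - 1) * (?M t - cw t * ?M' (cw t) \<epsilon>) + of_real a * (?M t * (1 - ?M t))) / (?M t)\<^sup>2"
        unfolding 1 2 by (simp only: add_divide_distrib)
      also have "cw t * (cw t - 1) * (?M t - cw t * ?M' (cw t) \<epsilon>) =
          of_real a * of_real \<epsilon> * (cw t * (cw t - 1) * (?M t - cw t * ?M' (cw t) \<epsilon>))"
        unfolding ae by simp
      also have "(\<dots> + of_real a * (?M t * (1 - ?M t))) = of_real a * (cw t * (cw t - 1)) * ?r"
        unfolding 3 by (simp add: algebra_simps)
      finally have "norm (of_real t * S' t + of_real a / cw t * S t - of_real a)
          = a * (norm (cw t) * norm (cw t - 1)) * norm ?r / (norm (?M t))\<^sup>2"
        using a by (simp add: norm_mult norm_divide norm_power)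
      also have "\<dots> \<le> a * (norm (cw t) * norm (cw t - 1)) * (C * \<epsilon> ^ Suc N) / (1 / 2)\<^sup>2"
        using a C(1) e(1) low[of t]
        by (intro frac_le mult_left_mono C(2) norm_cw_le_1 e power_mono mult_nonneg_nonneg) auto
      also have "\<dots> = 4 * C * \<epsilon> ^ N * (a * \<epsilon>) * (norm (cw t) * norm (cw t - 1))"
        by (simp add: power2_eq_square)
      finally show "norm (of_real t * S' t + of_real a / cw t * S t - of_real a)
          \<le> 4 * C * \<epsilon> ^ N * (norm (cw t) * norm (cw t - 1))" unfolding e(3) by simp
    qed (use a \<theta> in auto)
    also have "\<dots> \<le> (4 * C * \<epsilon> ^ N) / (a / 2) * (norm (cw \<theta>) * 1)"
      using a C(1) e(1) norm_cw_minus_1[OF \<theta>] by (intro mult_mono frac_le mult_left_mono) auto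
    also have "\<dots> = 8 * C * \<epsilon> ^ Suc N * norm (cw \<theta>)" by (simp add: \<epsilon>_def)
    finally have diff: "norm (Ti_amplitude a \<theta> - S \<theta>) \<le> 8 * C * \<epsilon> ^ Suc N * norm (cw \<theta>)" .
    have "Ti_ratio a \<theta> * ?M \<theta> - 1 = (Ti_amplitude a \<theta> - S \<theta>) / cw \<theta> * ?M \<theta>"
      using nz[of \<theta>] cw_nonzero[of \<theta>] by (simp add: Ti_ratio_def S_def field_simps)
    then have "norm (Ti_ratio a \<theta> * ?M \<theta> - 1) = norm (Ti_amplitude a \<theta> - S \<theta>) / norm (cw \<theta>) * norm (?M \<theta>)"
      by (simp add: norm_mult norm_divide)
    also have "\<dots> \<le> (8 * C * \<epsilon> ^ Suc N * norm (cw \<theta>)) / norm (cw \<theta>) * 2"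
      using diff up[of \<theta>] C(1) e(1) by (intro mult_mono divide_right_mono) auto
    also have "\<dots> = 16 * C * \<epsilon> ^ Suc N" using cw_nonzero[of \<theta>] by simp
    finally show "norm (Ti_ratio a \<theta> * recip_sum N (cw \<theta>) (1 / a) - 1) \<le> 16 * C * (1 / a) ^ Suc N"
      unfolding \<epsilon>_def .
  qed (use C in auto)
qed

text \<open>
  Since K M and M e^\<Lambda> are both close to 1, so is D = K e^(-\<Lambda>); thus log K = \<Lambda> + log D with a small
  log D, and the imaginary part of \<Lambda> is the sum of the L_coeff s \<theta> / a^s.
\<close>
lemma Ti_phase_expansion:
  obtains C A where "A \<ge> 4" "C \<ge> 0"
    "\<And>a \<theta>. a \<ge> A \<Longrightarrow> \<theta> > 0 \<Longrightarrow>
       \<bar>Ti_phase a \<theta> - (a * \<theta> - arctan \<theta> + (\<Sum>s=1..N. L_coeff s \<theta> / a ^ s))\<bar> \<le> C / a ^ Suc N"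
proof -
  obtain C1 A1 where 1: "A1 \<ge> 2" "C1 \<ge> 0"
    "\<And>a \<theta>. a \<ge> A1 \<Longrightarrow> \<theta> > 0 \<Longrightarrow>
       norm (Ti_ratio a \<theta> * recip_sum N (cw \<theta>) (1 / a) - 1) \<le> C1 * (1 / a) ^ Suc N"
    by (rule Ti_ratio_expansion) (rule that)
  obtain C2 where C2: "C2 \<ge> 0" "\<And>w \<epsilon>. norm w \<le> 1 \<Longrightarrow> 0 < \<epsilon> \<Longrightarrow> \<epsilon> \<le> 1 \<Longrightarrow>
    norm (recip_sum N w \<epsilon> * exp (phase_sum N w \<epsilon>) - 1) \<le> C2 * \<epsilon> ^ Suc N"
    by (rule recip_times_exp_phase) (rule that)
  obtain C3 where C3: "C3 \<ge> 0" "\<And>w \<epsilon>. norm w \<le> 1 \<Longrightarrow> 0 < \<epsilon> \<Longrightarrow> \<epsilon> \<le> 1 \<Longrightarrow> norm (phase_sum N w \<epsilon>) \<le> C3 * \<epsilon>"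
    by (rule phase_sum_small) (rule that)
  define C where "C = 2 * (C1 + C2)"
  have C0: "C \<ge> 0" using 1 C2 by (simp add: C_def)
  (* Large enough for G to stay away from 0 and for the imaginary part of \<Lambda> + Ln D to stay
     below \<pi>. *)
  define A where "A = Max {4, A1, 2 * C2, 4 * C, C3}"
  show thesis
  proof (rule that[of A "2 * C"])
    fix a \<theta> :: real assume "a \<ge> A" and \<theta>: "\<theta> > 0"
    then have a: "a \<ge> 4" "a \<ge> A1" "a \<ge> 2 * C2" "a \<ge> 4 * C" "a \<ge> C3" by (auto simp: A_def)
    define \<epsilon> where "\<epsilon> = 1 / a"
    have e: "0 < \<epsilon>" "\<epsilon> \<le> 1" "C2 * \<epsilon> \<le> 1 / 2" "C * \<epsilon> \<le> 1 / 4" "C3 * \<epsilon> \<le> 1"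
      using a by (auto simp: \<epsilon>_def field_simps)
    have pow: "\<epsilon> ^ Suc N \<le> \<epsilon>" using e power_decreasing[of 1 "Suc N" \<epsilon>] by simp
    define M where "M = recip_sum N (cw \<theta>) \<epsilon>"
    define \<Lambda> where "\<Lambda> = phase_sum N (cw \<theta>) \<epsilon>"
    define K where "K = Ti_ratio a \<theta>"
    define G where "G = M * exp \<Lambda>"
    have KM: "norm (K * M - 1) \<le> C1 * \<epsilon> ^ Suc N"
      using 1(3)[OF a(2) \<theta>] by (simp add: K_def M_def \<epsilon>_def)
    have G: "norm (G - 1) \<le> C2 * \<epsilon> ^ Suc N"
      unfolding G_def M_def \<Lambda>_def by (rule C2(2)[OF norm_cw_le_1 e(1,2)])
    also have "\<dots> \<le> C2 * \<epsilon>" using pow C2(1) by (rule mult_left_mono)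
    finally have "norm (G - 1) \<le> 1 / 2" using e(3) by linarith
    then have low: "1 / 2 \<le> norm G"
      using norm_triangle_ineq2[of 1 "1 - G"] by (simp add: norm_minus_commute)
    then have nz: "G \<noteq> 0" "M \<noteq> 0" by (auto simp: G_def)
    define D where "D = K * exp (- \<Lambda>)"
    have "D - 1 = (K * M - G) / G"
      using nz by (simp add: D_def G_def exp_minus field_simps)
    then have "norm (D - 1) = norm ((K * M - 1) - (G - 1)) / norm G" by (simp add: norm_divide)
    also have "\<dots> \<le> (C1 * \<epsilon> ^ Suc N + C2 * \<epsilon> ^ Suc N) / (1 / 2)"
      using low norm_triangle_le_diff[OF add_mono[OF KM G]] 1(2) C2(1) e(1)
      by (intro frac_le add_nonneg_nonneg mult_nonneg_nonneg) auto
    also have "\<dots> = C * \<epsilon> ^ Suc N" by (simp add: C_def algebra_simps)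
    finally have D: "norm (D - 1) \<le> C * \<epsilon> ^ Suc N" .
    also have "\<dots> \<le> C * \<epsilon>" using pow C0 by (rule mult_left_mono)
    finally have D14: "norm (D - 1) \<le> 1 / 4" using e(4) by linarith
    then have Dnz: "D \<noteq> 0" by auto
    have LD: "norm (Ln D) \<le> 2 * norm (D - 1)"
      using norm_Ln_le[of "D - 1"] D14 by simp
    have "K = exp (\<Lambda> + Ln D)" using Dnz by (simp add: exp_add D_def exp_minus)
    moreover have "Ln (exp (\<Lambda> + Ln D)) = \<Lambda> + Ln D"
    proof -
      have "norm \<Lambda> \<le> 1"
        unfolding \<Lambda>_def using C3(2)[OF norm_cw_le_1[of \<theta>] e(1,2)] e(5) by linarith
      then have "norm (\<Lambda> + Ln D) \<le> 2" using LD D14 norm_triangle_ineq[of \<Lambda> "Ln D"] by linarith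
      then have "\<bar>Im (\<Lambda> + Ln D)\<bar> \<le> 2" using abs_Im_le_cmod order_trans by blast
      then show ?thesis using pi_gt3 by (intro Ln_exp) linarith+
    qed
    ultimately have "Im (Ln K) = Im \<Lambda> + Im (Ln D)" by simp
    moreover have "Im \<Lambda> = (\<Sum>s=1..N. L_coeff s \<theta> / a ^ s)"
    proof -
      have "\<Lambda> = (\<Sum>s\<in>{1..N}. poly (phase_poly s) (cw \<theta>) * of_real \<epsilon> ^ s)"
        unfolding \<Lambda>_def eps_poly_def by (rule sum.mono_neutral_right) (auto simp: phase_poly_def not_le)
      also have "Im \<dots> = (\<Sum>s\<in>{1..N}. Im (poly (phase_poly s) (cw \<theta>)) * \<epsilon> ^ s)"
        by (simp del: of_real_power add: of_real_power[symmetric])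
      also have "\<dots> = (\<Sum>s=1..N. L_coeff s \<theta> / a ^ s)"
        by (intro sum.cong) (auto simp: L_coeff_eq phase_poly_def \<epsilon>_def power_one_over)
      finally show ?thesis .
    qed
    ultimately have "Ti_phase a \<theta> - (a * \<theta> - arctan \<theta> + (\<Sum>s=1..N. L_coeff s \<theta> / a ^ s)) = Im (Ln D)"
      unfolding Ti_phase_eq[OF a(1) \<theta>] K_def by simp
    moreover have "\<bar>Im (Ln D)\<bar> \<le> 2 * C * \<epsilon> ^ Suc N"
      using abs_Im_le_cmod[of "Ln D"] LD D by linarith
    ultimately show "\<bar>Ti_phase a \<theta> - (a * \<theta> - arctan \<theta> + (\<Sum>s=1..N. L_coeff s \<theta> / a ^ s))\<bar> \<le> 2 * C / a ^ Suc N"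
      by (simp add: \<epsilon>_def power_one_over)
  qed (use C0 in \<open>auto simp: A_def\<close>)
qed

section \<open>The zeros\<close>

theorem mainTheorem6:
  fixes \<alpha> :: real and N :: nat
  assumes "0 \<le> \<alpha>" and "\<alpha> < 1" and "N \<ge> 1"
  shows "\<exists>C. \<forall>\<^sub>F a in at_top. \<forall>m\<ge>1.
    \<bar>Ti_zero \<alpha> a m - t_approx \<alpha> a m - (\<Sum>k=2..N. q_coeff k (t_approx \<alpha> a m) / a ^ k)\<bar>
      \<le> C / a ^ (N + 1)"
proof -
  obtain C1 A where 1: "A \<ge> 4" "C1 \<ge> 0"
    "\<And>a \<theta>. a \<ge> A \<Longrightarrow> \<theta> > 0 \<Longrightarrow>
       \<bar>Ti_phase a \<theta> - (a * \<theta> - arctan \<theta> + (\<Sum>s=1..N. L_coeff s \<theta> / a ^ s))\<bar> \<le> C1 / a ^ Suc N"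
    by (rule Ti_phase_expansion) (rule that)
  define \<theta> where "\<theta> = (\<lambda>(a::real) x. x + (\<Sum>k=2..N. q_coeff k x / a ^ k))"
  define \<Phi> where "\<Phi> = (\<lambda>(a::real) x. a * x - arctan x + (\<Sum>s=1..N. L_coeff s x / a ^ s))"
  obtain C2 where 2: "C2 \<ge> 0"
    "\<And>a x. a \<ge> 1 \<Longrightarrow> \<bar>\<Phi> a (\<theta> a x) - (a * x - arctan x)\<bar> \<le> C2 / a ^ N"
    by (rule theta_partial_sum_residual[of N]) (rule that, assumption, simp only: \<Phi>_def \<theta>_def)
  have "\<exists>B. B \<ge> 0 \<and> (\<forall>u v. \<bar>L_coeff s u - L_coeff s v\<bar> \<le> B * \<bar>u - v\<bar>)" if "s \<ge> 1" for s
    using bounded_derivs_lipschitz[OF bounded_derivs_L_coeff[OF that]] by metis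
  then obtain B where B: "\<And>s. s \<ge> 1 \<Longrightarrow> B s \<ge> 0"
    "\<And>s u v. s \<ge> 1 \<Longrightarrow> \<bar>L_coeff s u - L_coeff s v\<bar> \<le> B s * \<bar>u - v\<bar>" by metis
  obtain B0 where B0: "B0 \<ge> 0" "\<And>u v. \<bar>arctan u - arctan v\<bar> \<le> B0 * \<bar>u - v\<bar>"
    by (rule bounded_derivs_lipschitz[OF bounded_derivs_arctan]) (rule that)
  define E where "E = B0 + (\<Sum>s=1..N. B s)"
  (* The linear term dominates the Lipschitz functions, so an error in the equation is
     divided by a/2 on passing to the solution. *)
  have expansive: "a / 2 * \<bar>u - v\<bar> \<le> \<bar>\<Phi> a u - \<Phi> a v\<bar>" if a: "a \<ge> 1" "a \<ge> 2 * E" for a u v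
  proof -
    have "\<bar>(\<Sum>s=1..N. L_coeff s u / a ^ s) - (\<Sum>s=1..N. L_coeff s v / a ^ s)\<bar> \<le> (\<Sum>s=1..N. B s * \<bar>u - v\<bar>)"
      unfolding sum_subtractf[symmetric]
    proof (rule order_trans[OF sum_abs sum_mono])
      fix s assume "s \<in> {1..N}"
      then have s: "s \<ge> 1" by simp
      have "\<bar>L_coeff s u / a ^ s - L_coeff s v / a ^ s\<bar> = \<bar>L_coeff s u - L_coeff s v\<bar> / a ^ s"
        using a by (simp add: diff_divide_distrib[symmetric])
      also have "\<dots> \<le> \<bar>L_coeff s u - L_coeff s v\<bar> / 1"
        using a by (intro divide_left_mono) auto
      also have "\<dots> \<le> B s * \<bar>u - v\<bar>" using B(2)[OF s] by simp
      finally show "\<bar>L_coeff s u / a ^ s - L_coeff s v / a ^ s\<bar> \<le> B s * \<bar>u - v\<bar>" .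
    qed
    moreover have "a * \<bar>u - v\<bar> = \<bar>a * u - a * v\<bar>"
      using a by (simp add: abs_mult right_diff_distrib[symmetric])
    moreover have "E * \<bar>u - v\<bar> = B0 * \<bar>u - v\<bar> + (\<Sum>s=1..N. B s * \<bar>u - v\<bar>)"
      by (simp add: E_def distrib_right sum_distrib_right)
    moreover have "E * \<bar>u - v\<bar> \<le> a / 2 * \<bar>u - v\<bar>" using a by (intro mult_right_mono) auto
    moreover have "\<bar>d\<bar> \<le> \<bar>d - e + f\<bar> + \<bar>e\<bar> + \<bar>f\<bar>" for d e f :: real by linarith
    note this[of "a * u - a * v" "arctan u - arctan v"
        "(\<Sum>s=1..N. L_coeff s u / a ^ s) - (\<Sum>s=1..N. L_coeff s v / a ^ s)"]
    moreover have "\<Phi> a u - \<Phi> a v = (a * u - a * v) - (arctan u - arctan v)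
        + ((\<Sum>s=1..N. L_coeff s u / a ^ s) - (\<Sum>s=1..N. L_coeff s v / a ^ s))"
      by (simp add: \<Phi>_def)
    moreover note B0(2)[of u v]
    ultimately show ?thesis by linarith
  qed
  have "\<forall>m\<ge>1. \<bar>Ti_zero \<alpha> a m - \<theta> a (t_approx \<alpha> a m)\<bar> \<le> (2 * (C1 + C2)) / a ^ (N + 1)"
    if "a \<ge> max A (2 * E)" for a
  proof (intro allI impI)
    fix m :: nat assume m: "m \<ge> 1"
    have a: "a \<ge> A" "a \<ge> 4" "a \<ge> 1" "a \<ge> 2 * E" using that 1(1) by auto
    define t where "t = Ti_zero \<alpha> a m"
    define x where "x = t_approx \<alpha> a m"
    have t: "t > 0" "Ti_phase a t = a * x - arctan x"
      using Ti_zero_phase[OF a(2) assms(1,2) m] t_approx_eq[OF _ assms(1,2) m, of a] a by (simp_all add: t_def x_def)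
    have "\<bar>(a * x - arctan x) - \<Phi> a t\<bar> \<le> C1 / a ^ Suc N"
      using 1(3)[OF a(1) t(1)] by (simp only: t(2) \<Phi>_def)
    then have "\<bar>\<Phi> a t - \<Phi> a (\<theta> a x)\<bar> \<le> C1 / a ^ Suc N + C2 / a ^ N"
      using 2(2)[OF a(3), of x] by linarith
    also have "C1 / a ^ Suc N \<le> C1 / a ^ N"
      using 1(2) a by (intro divide_left_mono power_increasing) auto
    finally have "a / 2 * \<bar>t - \<theta> a x\<bar> \<le> (C1 + C2) / a ^ N"
      using expansive[OF a(3,4), of t "\<theta> a x"] unfolding add_divide_distrib by linarith
    then show "\<bar>Ti_zero \<alpha> a m - \<theta> a (t_approx \<alpha> a m)\<bar> \<le> (2 * (C1 + C2)) / a ^ (N + 1)"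
      unfolding t_def[symmetric] x_def[symmetric] using a by (simp add: field_simps)
  qed
  then have "\<forall>\<^sub>F a in at_top. \<forall>m\<ge>1. \<bar>Ti_zero \<alpha> a m - \<theta> a (t_approx \<alpha> a m)\<bar> \<le> (2 * (C1 + C2)) / a ^ (N + 1)"
    unfolding eventually_at_top_linorder by blast
  then show ?thesis
    unfolding \<theta>_def diff_diff_eq by (rule exI)
qed

end
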